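(* The following problem is undecidable: given two finite iCGS $\mathcal G_1$ and $\mathcal G_2$ defined on the same set $Ag$ of agents and a set $A\subseteq Ag$ of agents, decide whether $\mathcal G_1$ and $\mathcal G_2$ are $A$-bisimilar.
   Context: An iCGS is $\langle Ag,S,s_0,Act,\{\sim_i\}_{i\in Ag},d,\to,\pi\rangle$ with states $S$, initial state $s_0$, finite actions $Act$, equivalence relations $\sim_i$ on $S$, protocol $d:Ag\times S\to2^{Act}\setminus\{\emptyset\}$ constant on $\sim_i$-classes, transition relation $\to\subseteq S\times Act^{Ag}\times S$ with a successor for joint action $\vec a$ at $s$ iff $a_i\in d(i,s)$ for all $i$, and labelling $\pi$; finite means $S$ finite. Histories are finite runs from the initial state; $h\sim_ih'$ iff same length, pointwise $\sim_i$ states and same actions of $i$; $C_A(h)$ is the class of $h$ under the transitive closure of $\bigcup_{i\in A}\sim_i$; $PStr_A(Q)$ denotes tuples of partial functions on $Q$ choosing enabled actions and equal on $\sim_i$-related histories; $succ(k,\sigma)$ the one-step extensions of $k$ by joint actions agreeing with $\sigma(k)$ on $A$. A relation $R\subseteq Hist(\mathcal G_1)\times Hist(\mathcal G_2)$ is an $A$-simulation if for some family of maps $ST:PStr_A(C_A(h))\to PStr_A(C_A(h'))$ depending only on the pair of neighbourhoods, $hRh'$ implies (1) equal labels of last states; (2) for $i\in A$ and $h'\sim_ik'$ there is $k$ with $h\sim_ik$, $kRk'$; (3) for $k\in C_A(h),k'\in C_A(h')$ with $kRk'$, every $\sigma_A\in PStr_A(C_A(h))$ and every $l'\in succ(k',ST(\sigma_A))$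 there is $l\in succ(k,\sigma_A)$ with $lRl'$. An $A$-bisimulation is a simulation whose converse is a simulation; $\mathcal G_1,\mathcal G_2$ are $A$-bisimilar if some $A$-bisimulation relates their initial states. *)

theory Defs
  imports "HOL-Library.FuncSet" "HOL-Library.Nat_Bijection"
begin

section \<open>Recursive functions and decidability\<close>

datatype recf =
    Zero
  | Succ
  | Proj nat
  | Comp recf "recf list"
  | Prim_Rec recf recf
  | Mu recf

text \<open>
  \<open>evaluates r xs y\<close>: the partial recursive function denoted by \<open>r\<close> is defined at the argument
  tuple \<open>xs\<close> and has value \<open>y\<close> there.
\<close>

inductive evaluates :: "recf \<Rightarrow> nat list \<Rightarrow> nat \<Rightarrow> bool" where
  Zero: "evaluates Zero xs 0"
| Succ: "evaluates Succ [x] (Suc x)"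
| Proj: "i < length xs \<Longrightarrow> evaluates (Proj i) xs (xs ! i)"
| Comp: "list_all2 (\<lambda>g y. evaluates g xs y) gs ys \<Longrightarrow> evaluates f ys z \<Longrightarrow>
    evaluates (Comp f gs) xs z"
| Prim_Rec_0: "evaluates f xs y \<Longrightarrow> evaluates (Prim_Rec f g) (0 # xs) y"
| Prim_Rec_Suc: "evaluates (Prim_Rec f g) (n # xs) y \<Longrightarrow> evaluates g (n # y # xs) z \<Longrightarrow>
    evaluates (Prim_Rec f g) (Suc n # xs) z"
| Mu: "evaluates f (n # xs) 0 \<Longrightarrow> \<forall>m<n. \<exists>y. evaluates f (m # xs) (Suc y) \<Longrightarrow>
    evaluates (Mu f) xs n"

inductive_cases evaluates_elims:
  "evaluates Zero xs y"
  "evaluates Succ xs y"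
  "evaluates (Proj i) xs y"
  "evaluates (Comp f gs) xs y"
  "evaluates (Prim_Rec f g) (0 # xs) y"
  "evaluates (Prim_Rec f g) (Suc n # xs) y"
  "evaluates (Mu f) xs y"

lemma evaluates_deterministic:
  assumes "evaluates r xs y" "evaluates r xs z"
  shows "y = z"
  using assms
proof (induction arbitrary: z rule: evaluates.induct)
  case (Comp xs gs ys f w)
  from evaluates_elims(4)[OF Comp.prems] obtain ys' where
    ys': "list_all2 (\<lambda>g y. evaluates g xs y) gs ys'" "evaluates f ys' z"
    by metis
  have "ys = ys'"
    using Comp.IH(1) ys'(1) unfolding list_all2_conv_all_nth by (metis nth_equalityI)
  with Comp.IH(2) ys'(2) show ?case by blast
next
  case (Prim_Rec_Suc f g n xs y w)
  from evaluates_elims(6)[OF Prim_Rec_Suc.prems] obtain y' where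
    "evaluates (Prim_Rec f g) (n # xs) y'" "evaluates g (n # y' # xs) z"
    by metis
  with Prim_Rec_Suc.IH show ?case by blast
next
  case (Mu f n xs)
  from evaluates_elims(7)[OF Mu.prems] have
    z: "evaluates f (z # xs) 0" "\<forall>m<z. \<exists>y. evaluates f (m # xs) (Suc y)"
    by metis+
  have "\<not> n < z"
    using z(2) Mu.IH(1) by blast
  moreover have "\<not> z < n"
    using z(1) Mu.IH(2) by blast
  ultimately show ?case by simp
next
  case (Zero xs) then show ?case by (metis evaluates_elims(1))
next
  case (Succ x) then show ?case by (metis evaluates_elims(2) list.inject)
next
  case (Proj i xs) from this(2) show ?case by (metis evaluates_elims(3))
next
  case (Prim_Rec_0 f xs y g) then show ?case by (metis evaluates_elims(5))
qed

text \<open>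
  The problem with inputs \<open>X\<close>, presented to the algorithm through \<open>code\<close>, and question \<open>P\<close> is
  decidable.  Nothing is asked of the algorithm on numbers that do not code an input.
\<close>

definition decidable :: "'x set \<Rightarrow> ('x \<Rightarrow> nat) \<Rightarrow> ('x \<Rightarrow> bool) \<Rightarrow> bool" where
  "decidable X code P \<longleftrightarrow>
    (\<exists>r. \<forall>x\<in>X. evaluates r [code x] (if P x then 1 else 0))"


section \<open>Concurrent game structures with imperfect information\<close>

record ('i, 's, 'c, 'p) icgs =
  agents :: "'i set"
  states :: "'s set"
  init :: "'s"
  acts :: "'c set"
  indist :: "'i \<Rightarrow> ('s \<times> 's) set"
  protocol :: "'i \<Rightarrow> 's \<Rightarrow> 'c set"
  transitions :: "('s \<times> ('i \<Rightarrow> 'c) \<times> 's) set"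
  label :: "'s \<Rightarrow> 'p set"

definition joint_actions :: "('i, 's, 'c, 'p) icgs \<Rightarrow> ('i \<Rightarrow> 'c) set" where
  "joint_actions G = (agents G \<rightarrow>\<^sub>E acts G)"

definition is_icgs :: "('i, 's, 'c, 'p) icgs \<Rightarrow> bool" where
  "is_icgs G \<longleftrightarrow>
    init G \<in> states G \<and>
    finite (acts G) \<and>
    (\<forall>i\<in>agents G. equiv (states G) (indist G i)) \<and>
    (\<forall>i\<in>agents G. \<forall>s\<in>states G. protocol G i s \<subseteq> acts G \<and> protocol G i s \<noteq> {}) \<and>
    (\<forall>i\<in>agents G. \<forall>(s, t)\<in>indist G i. protocol G i s = protocol G i t) \<and>
    transitions G \<subseteq> states G \<times> joint_actions G \<times> states G \<and>
    (\<forall>s\<in>states G. \<forall>a\<in>joint_actions G.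
      (\<exists>t. (s, a, t) \<in> transitions G) \<longleftrightarrow> (\<forall>i\<in>agents G. a i \<in> protocol G i s))"

definition finite_icgs :: "('i, 's, 'c, 'p) icgs \<Rightarrow> bool" where
  "finite_icgs G \<longleftrightarrow> is_icgs G \<and> finite (states G)"


subsection \<open>Histories and neighbourhoods\<close>

text \<open>The run \<open>s\<^sub>0 a\<^sub>1 s\<^sub>1 \<dots> a\<^sub>n s\<^sub>n\<close> is \<open>Step (\<dots> (Step (Start s\<^sub>0) a\<^sub>1 s\<^sub>1) \<dots>) a\<^sub>n s\<^sub>n\<close>.\<close>

datatype ('i, 's, 'c) run =
    Start 's
  | Step "('i, 's, 'c) run" "'i \<Rightarrow> 'c" 's

fun last_state :: "('i, 's, 'c) run \<Rightarrow> 's" where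
  "last_state (Start s) = s"
| "last_state (Step h a s) = s"

inductive_set hist :: "('i, 's, 'c, 'p) icgs \<Rightarrow> ('i, 's, 'c) run set" for G where
  Start: "Start (init G) \<in> hist G"
| Step: "h \<in> hist G \<Longrightarrow> (last_state h, a, s) \<in> transitions G \<Longrightarrow> Step h a s \<in> hist G"

fun run_indist ::
  "('i, 's, 'c, 'p) icgs \<Rightarrow> 'i \<Rightarrow> ('i, 's, 'c) run \<Rightarrow> ('i, 's, 'c) run \<Rightarrow> bool" where
  "run_indist G i (Start s) (Start t) \<longleftrightarrow> (s, t) \<in> indist G i"
| "run_indist G i (Step h a s) (Step k b t) \<longleftrightarrow>
    run_indist G i h k \<and> a i = b i \<and> (s, t) \<in> indist G i"
| "run_indist G i _ _ \<longleftrightarrow> False"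

definition hist_indist ::
  "('i, 's, 'c, 'p) icgs \<Rightarrow> 'i \<Rightarrow> (('i, 's, 'c) run \<times> ('i, 's, 'c) run) set" where
  "hist_indist G i = {(h, k). h \<in> hist G \<and> k \<in> hist G \<and> run_indist G i h k}"

text \<open>
  For nonempty \<open>A\<close> the reflexive transitive closure agrees, on histories, with the transitive
  closure; for \<open>A = {}\<close> it makes the class of \<open>h\<close> the singleton \<open>{h}\<close>.
\<close>

definition nbhd ::
  "('i, 's, 'c, 'p) icgs \<Rightarrow> 'i set \<Rightarrow> ('i, 's, 'c) run \<Rightarrow> ('i, 's, 'c) run set" where
  "nbhd G A h = {k. (h, k) \<in> (\<Union>i\<in>A. hist_indist G i)\<^sup>*}"


subsection \<open>Partial strategies\<close>

type_synonym ('i, 's, 'c) strat = "'i \<Rightarrow> ('i, 's, 'c) run \<rightharpoonup> 'c"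

text \<open>
  A tuple indexed by \<open>A\<close> is a function on all agents that is the empty map outside \<open>A\<close>.
\<close>

definition pstr ::
  "('i, 's, 'c, 'p) icgs \<Rightarrow> 'i set \<Rightarrow> ('i, 's, 'c) run set \<Rightarrow> ('i, 's, 'c) strat set" where
  "pstr G A Q = {\<sigma>.
    (\<forall>i\<in>A. dom (\<sigma> i) = Q \<and>
      (\<forall>h\<in>Q. the (\<sigma> i h) \<in> protocol G i (last_state h)) \<and>
      (\<forall>h\<in>Q. \<forall>k\<in>Q. (h, k) \<in> hist_indist G i \<longrightarrow> \<sigma> i h = \<sigma> i k)) \<and>
    (\<forall>i. i \<notin> A \<longrightarrow> \<sigma> i = Map.empty)}"

definition succs ::
  "('i, 's, 'c, 'p) icgs \<Rightarrow> 'i set \<Rightarrow> ('i, 's, 'c) run \<Rightarrow> ('i, 's, 'c) strat \<Rightarrow>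
    ('i, 's, 'c) run set" where
  "succs G A k \<sigma> = {Step k a s | a s. Step k a s \<in> hist G \<and> (\<forall>i\<in>A. \<sigma> i k = Some (a i))}"


subsection \<open>Simulations and bisimulations\<close>

definition simulation ::
  "'i set \<Rightarrow> ('i, 's, 'c, 'p) icgs \<Rightarrow> ('i, 't, 'd, 'p) icgs \<Rightarrow>
    (('i, 's, 'c) run \<times> ('i, 't, 'd) run) set \<Rightarrow> bool" where
  "simulation A G1 G2 R \<longleftrightarrow>
    R \<subseteq> hist G1 \<times> hist G2 \<and>
    (\<exists>ST :: ('i, 's, 'c) run set \<Rightarrow> ('i, 't, 'd) run set \<Rightarrow>
        ('i, 's, 'c) strat \<Rightarrow> ('i, 't, 'd) strat.
      (\<forall>h\<in>hist G1. \<forall>h'\<in>hist G2.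
        ST (nbhd G1 A h) (nbhd G2 A h')
          \<in> pstr G1 A (nbhd G1 A h) \<rightarrow> pstr G2 A (nbhd G2 A h')) \<and>
      (\<forall>(h, h')\<in>R.
        label G1 (last_state h) = label G2 (last_state h') \<and>
        (\<forall>i\<in>A. \<forall>k'. (h', k') \<in> hist_indist G2 i \<longrightarrow>
          (\<exists>k. (h, k) \<in> hist_indist G1 i \<and> (k, k') \<in> R)) \<and>
        (\<forall>k\<in>nbhd G1 A h. \<forall>k'\<in>nbhd G2 A h'. (k, k') \<in> R \<longrightarrow>
          (\<forall>\<sigma>\<in>pstr G1 A (nbhd G1 A h).
            \<forall>l'\<in>succs G2 A k' (ST (nbhd G1 A h) (nbhd G2 A h') \<sigma>).
              \<exists>l\<in>succs G1 A k \<sigma>. (l, l') \<in> R))))"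

definition bisimulation ::
  "'i set \<Rightarrow> ('i, 's, 'c, 'p) icgs \<Rightarrow> ('i, 't, 'd, 'p) icgs \<Rightarrow>
    (('i, 's, 'c) run \<times> ('i, 't, 'd) run) set \<Rightarrow> bool" where
  "bisimulation A G1 G2 R \<longleftrightarrow> simulation A G1 G2 R \<and> simulation A G2 G1 (R\<inverse>)"

definition bisimilar ::
  "'i set \<Rightarrow> ('i, 's, 'c, 'p) icgs \<Rightarrow> ('i, 't, 'd, 'p) icgs \<Rightarrow> bool" where
  "bisimilar A G1 G2 \<longleftrightarrow>
    (\<exists>R. bisimulation A G1 G2 R \<and> (Start (init G1), Start (init G2)) \<in> R)"


section \<open>The bisimilarity problem\<close>

text \<open>
  Agents, states, actions and atoms of a finite structure are named by natural numbers.  The last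
  three conditions make an input a finite object: \<^const>\<open>finite_icgs\<close> bounds neither the set of
  agents nor the sets of atoms labelling the states.
\<close>

type_synonym nat_icgs = "(nat, nat, nat, nat) icgs"

definition inputs :: "(nat_icgs \<times> nat_icgs \<times> nat set) set" where
  "inputs = {(G1, G2, A).
    finite_icgs G1 \<and> finite_icgs G2 \<and> agents G1 = agents G2 \<and> A \<subseteq> agents G1 \<and>
    finite (agents G1) \<and>
    (\<forall>s\<in>states G1. finite (label G1 s)) \<and> (\<forall>s\<in>states G2. finite (label G2 s))}"

text \<open>
  \<^const>\<open>set_encode\<close> is only meaningful on finite sets, and all sets below are finite for the
  structures occurring in \<^const>\<open>inputs\<close>.  A joint action is coded by its graph.
\<close>

definition joint_code :: "nat set \<Rightarrow> (nat \<Rightarrow> nat) \<Rightarrow> nat" where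
  "joint_code I a = set_encode ((\<lambda>i. prod_encode (i, a i)) ` I)"

definition icgs_code :: "nat_icgs \<Rightarrow> nat" where
  "icgs_code G = list_encode
    [set_encode (agents G),
     set_encode (states G),
     init G,
     set_encode (acts G),
     set_encode {prod_encode (i, prod_encode (s, t)) | i s t.
       i \<in> agents G \<and> (s, t) \<in> indist G i},
     set_encode {prod_encode (i, prod_encode (s, c)) | i s c.
       i \<in> agents G \<and> s \<in> states G \<and> c \<in> protocol G i s},
     set_encode {prod_encode (s, prod_encode (joint_code (agents G) a, t)) | s a t.
       (s, a, t) \<in> transitions G},
     set_encode {prod_encode (s, p) | s p. s \<in> states G \<and> p \<in> label G s}]"

lemma set_encode_eq_imp:
  assumes "set_encode X = set_encode Y" "finite X" "finite Y"
  shows "X = Y"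
  using assms by (metis set_encode_inverse)

lemma joint_code_eq_imp:
  assumes "finite I" "a \<in> I \<rightarrow>\<^sub>E X" "b \<in> I \<rightarrow>\<^sub>E Y" "joint_code I a = joint_code I b"
  shows "a = b"
proof -
  have eq: "(\<lambda>i. prod_encode (i, a i)) ` I = (\<lambda>i. prod_encode (i, b i)) ` I"
    using assms(1,4) unfolding joint_code_def by (intro set_encode_eq_imp) auto
  then have "a i = b i" if "i \<in> I" for i
  proof -
    have "prod_encode (i, a i) \<in> (\<lambda>i. prod_encode (i, b i)) ` I"
      using that by (subst eq[symmetric]) blast
    then show ?thesis by auto
  qed
  then show ?thesis
    using assms(2,3) by (intro extensionalityI[of a I b]) (auto simp: PiE_def)
qed

lemma finite_code_sets:
  fixes G :: nat_icgs
  assumes "finite_icgs G" "finite (agents G)" "\<forall>s\<in>states G. finite (label G s)"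
  shows "finite (acts G)" "finite (states G)"
    "finite {prod_encode (i, prod_encode (s, t)) | i s t. i \<in> agents G \<and> (s, t) \<in> indist G i}"
    "finite {prod_encode (i, prod_encode (s, c)) | i s c.
       i \<in> agents G \<and> s \<in> states G \<and> c \<in> protocol G i s}"
    "finite {prod_encode (s, prod_encode (joint_code (agents G) a, t))
      | s a t. (s, a, t) \<in> transitions G}"
    "finite {prod_encode (s, p) | s p. s \<in> states G \<and> p \<in> label G s}"
proof -
  have G: "is_icgs G" and S: "finite (states G)"
    using assms(1) by (auto simp: finite_icgs_def)
  show S': "finite (states G)" by (fact S)
  show C: "finite (acts G)" using G by (simp add: is_icgs_def)
  have I: "indist G i \<subseteq> states G \<times> states G" if "i \<in> agents G" for i
    using G that by (auto simp: is_icgs_def equiv_def)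
  have "{prod_encode (i, prod_encode (s, t)) | i s t. i \<in> agents G \<and> (s, t) \<in> indist G i}
    \<subseteq> (\<lambda>(i, s, t). prod_encode (i, prod_encode (s, t))) ` (agents G \<times> states G \<times> states G)"
  proof clarify
    fix i s t assume "i \<in> agents G" "(s, t) \<in> indist G i"
    with I show "prod_encode (i, prod_encode (s, t)) \<in>
        (\<lambda>(i, s, t). prod_encode (i, prod_encode (s, t))) ` (agents G \<times> states G \<times> states G)"
      by (intro image_eqI[of _ _ "(i, s, t)"]) auto
  qed
  then show "finite {prod_encode (i, prod_encode (s, t)) | i s t.
      i \<in> agents G \<and> (s, t) \<in> indist G i}"
    by (rule finite_subset) (use assms(2) S in auto)
  have P: "protocol G i s \<subseteq> acts G" if "i \<in> agents G" "s \<in> states G" for i s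
    using G that by (auto simp: is_icgs_def)
  have "{prod_encode (i, prod_encode (s, c)) | i s c.
       i \<in> agents G \<and> s \<in> states G \<and> c \<in> protocol G i s}
    \<subseteq> (\<lambda>(i, s, c). prod_encode (i, prod_encode (s, c))) ` (agents G \<times> states G \<times> acts G)"
  proof clarify
    fix i s c assume "i \<in> agents G" "s \<in> states G" "c \<in> protocol G i s"
    with P show "prod_encode (i, prod_encode (s, c)) \<in>
        (\<lambda>(i, s, c). prod_encode (i, prod_encode (s, c))) ` (agents G \<times> states G \<times> acts G)"
      by (intro image_eqI[of _ _ "(i, s, c)"]) auto
  qed
  then show "finite {prod_encode (i, prod_encode (s, c)) | i s c.
       i \<in> agents G \<and> s \<in> states G \<and> c \<in> protocol G i s}"
    by (rule finite_subset) (use assms(2) S C in auto)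
  have "finite (joint_actions G)"
    unfolding joint_actions_def using assms(2) C by (intro finite_PiE) auto
  moreover have "transitions G \<subseteq> states G \<times> joint_actions G \<times> states G"
    using G by (simp add: is_icgs_def)
  ultimately have "finite (transitions G)"
    using S by (meson finite_SigmaI finite_subset)
  moreover have "{prod_encode (s, prod_encode (joint_code (agents G) a, t)) | s a t.
      (s, a, t) \<in> transitions G}
    = (\<lambda>(s, a, t). prod_encode (s, prod_encode (joint_code (agents G) a, t))) ` transitions G"
    by force
  ultimately show "finite {prod_encode (s, prod_encode (joint_code (agents G) a, t)) | s a t.
      (s, a, t) \<in> transitions G}"
    by simp
  have "{prod_encode (s, p) | s p. s \<in> states G \<and> p \<in> label G s}
    = (\<Union>s\<in>states G. (\<lambda>p. prod_encode (s, p)) ` label G s)"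
    by auto
  then show "finite {prod_encode (s, p) | s p. s \<in> states G \<and> p \<in> label G s}"
    using S assms(3) by simp
qed

text \<open>The code determines the structure, up to irrelevant values outside the domains.\<close>

lemma icgs_code_eq_imp:
  assumes G: "finite_icgs G" "finite (agents G)" "\<forall>s\<in>states G. finite (label G s)"
    and H: "finite_icgs H" "finite (agents H)" "\<forall>s\<in>states H. finite (label H s)"
    and eq: "icgs_code G = icgs_code H"
  shows "agents G = agents H" "states G = states H" "init G = init H" "acts G = acts H"
    "\<forall>i\<in>agents G. indist G i = indist H i"
    "\<forall>i\<in>agents G. \<forall>s\<in>states G. protocol G i s = protocol H i s"
    "transitions G = transitions H"
    "\<forall>s\<in>states G. label G s = label H s"
proof -
  note fG = finite_code_sets[OF G] and fH = finite_code_sets[OF H]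
  from eq[unfolded icgs_code_def, THEN arg_cong, of list_decode]
  have E1: "set_encode (agents G) = set_encode (agents H)"
    and E2: "set_encode (states G) = set_encode (states H)"
    and E3: "init G = init H"
    and E4: "set_encode (acts G) = set_encode (acts H)"
    and E5: "set_encode {prod_encode (i, prod_encode (s, t)) | i s t.
        i \<in> agents G \<and> (s, t) \<in> indist G i}
      = set_encode {prod_encode (i, prod_encode (s, t)) | i s t.
        i \<in> agents H \<and> (s, t) \<in> indist H i}"
    and E6: "set_encode {prod_encode (i, prod_encode (s, c)) | i s c.
        i \<in> agents G \<and> s \<in> states G \<and> c \<in> protocol G i s}
      = set_encode {prod_encode (i, prod_encode (s, c)) | i s c.
        i \<in> agents H \<and> s \<in> states H \<and> c \<in> protocol H i s}"
    and E7: "set_encode {prod_encode (s, prod_encode (joint_code (agents G) a, t))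
        | s a t. (s, a, t) \<in> transitions G}
      = set_encode {prod_encode (s, prod_encode (joint_code (agents H) a, t))
        | s a t. (s, a, t) \<in> transitions H}"
    and E8: "set_encode {prod_encode (s, p) | s p. s \<in> states G \<and> p \<in> label G s}
      = set_encode {prod_encode (s, p) | s p. s \<in> states H \<and> p \<in> label H s}"
    unfolding list_encode_inverse list.inject by blast+
  show ag: "agents G = agents H"
    by (rule set_encode_eq_imp[OF E1 G(2) H(2)])
  show st: "states G = states H"
    by (rule set_encode_eq_imp[OF E2 fG(2) fH(2)])
  show "init G = init H" by (fact E3)
  show ac: "acts G = acts H"
    by (rule set_encode_eq_imp[OF E4 fG(1) fH(1)])
  have "{prod_encode (i, prod_encode (s, t)) | i s t. i \<in> agents G \<and> (s, t) \<in> indist G i}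
    = {prod_encode (i, prod_encode (s, t)) | i s t. i \<in> agents H \<and> (s, t) \<in> indist H i}"
    by (rule set_encode_eq_imp[OF E5 fG(3) fH(3)])
  then have "(i \<in> agents G \<and> (s, t) \<in> indist G i) \<longleftrightarrow> (i \<in> agents H \<and> (s, t) \<in> indist H i)"
    for i s t
    by (auto simp: set_eq_iff dest!: spec[of _ "prod_encode (i, prod_encode (s, t))"])
  then show "\<forall>i\<in>agents G. indist G i = indist H i"
    using ag by auto
  have "{prod_encode (i, prod_encode (s, c)) | i s c.
       i \<in> agents G \<and> s \<in> states G \<and> c \<in> protocol G i s}
    = {prod_encode (i, prod_encode (s, c)) | i s c.
       i \<in> agents H \<and> s \<in> states H \<and> c \<in> protocol H i s}"
    by (rule set_encode_eq_imp[OF E6 fG(4) fH(4)])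
  then have "(i \<in> agents G \<and> s \<in> states G \<and> c \<in> protocol G i s)
    \<longleftrightarrow> (i \<in> agents H \<and> s \<in> states H \<and> c \<in> protocol H i s)" for i s c
    by (auto simp: set_eq_iff dest!: spec[of _ "prod_encode (i, prod_encode (s, c))"])
  then show "\<forall>i\<in>agents G. \<forall>s\<in>states G. protocol G i s = protocol H i s"
    using ag st by blast
  have T: "{prod_encode (s, prod_encode (joint_code (agents G) a, t))
      | s a t. (s, a, t) \<in> transitions G}
    = {prod_encode (s, prod_encode (joint_code (agents H) a, t))
      | s a t. (s, a, t) \<in> transitions H}"
    by (rule set_encode_eq_imp[OF E7 fG(5) fH(5)])
  have J: "a \<in> agents G \<rightarrow>\<^sub>E acts G" if "(s, a, t) \<in> transitions G \<or> (s, a, t) \<in> transitions H" for s a t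
    using that G(1) H(1) ag ac by (auto simp: finite_icgs_def is_icgs_def joint_actions_def)
  have 1: "\<exists>b. (s, b, t) \<in> transitions H \<and> joint_code (agents G) a = joint_code (agents G) b"
    if "(s, a, t) \<in> transitions G" for s a t
  proof -
    have "prod_encode (s, prod_encode (joint_code (agents G) a, t)) \<in>
      {prod_encode (s, prod_encode (joint_code (agents G) a, t))
      | s a t. (s, a, t) \<in> transitions G}"
      using that by blast
    then show ?thesis unfolding T using ag by auto
  qed
  have 2: "\<exists>b. (s, b, t) \<in> transitions G \<and> joint_code (agents G) a = joint_code (agents G) b"
    if "(s, a, t) \<in> transitions H" for s a t
  proof -
    have "prod_encode (s, prod_encode (joint_code (agents H) a, t)) \<in>
      {prod_encode (s, prod_encode (joint_code (agents H) a, t))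
      | s a t. (s, a, t) \<in> transitions H}"
      using that by blast
    then show ?thesis unfolding T[symmetric] using ag by auto
  qed
  show "transitions G = transitions H"
  proof (intro set_eqI iffI; clarify)
    fix s a t assume a: "(s, a, t) \<in> transitions G"
    with 1 obtain b
      where b: "(s, b, t) \<in> transitions H" "joint_code (agents G) a = joint_code (agents G) b"
      by blast
    have "a = b"
      by (rule joint_code_eq_imp[OF G(2) J[OF disjI1[OF a]] J[OF disjI2[OF b(1)]] b(2)])
    with b show "(s, a, t) \<in> transitions H" by simp
  next
    fix s a t assume a: "(s, a, t) \<in> transitions H"
    with 2 obtain b
      where b: "(s, b, t) \<in> transitions G" "joint_code (agents G) a = joint_code (agents G) b"
      by blast
    have "a = b"
      by (rule joint_code_eq_imp[OF G(2) J[OF disjI2[OF a]] J[OF disjI1[OF b(1)]] b(2)])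
    with b show "(s, a, t) \<in> transitions G" by simp
  qed
  have "{prod_encode (s, p) | s p. s \<in> states G \<and> p \<in> label G s}
    = {prod_encode (s, p) | s p. s \<in> states H \<and> p \<in> label H s}"
    by (rule set_encode_eq_imp[OF E8 fG(6) fH(6)])
  then have "(s \<in> states G \<and> p \<in> label G s) \<longleftrightarrow> (s \<in> states H \<and> p \<in> label H s)" for s p
    by (auto simp: set_eq_iff dest!: spec[of _ "prod_encode (s, p)"])
  then show "\<forall>s\<in>states G. label G s = label H s"
    using st by blast
qed

fun input_code :: "nat_icgs \<times> nat_icgs \<times> nat set \<Rightarrow> nat" where
  "input_code (G1, G2, A) = list_encode [icgs_code G1, icgs_code G2, set_encode A]"

end

theory Submission
  imports Defs "HOL-Library.Countable"
begin

text \<open>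
  With two agents and a single action strategies carry no information, and bisimilarity becomes
  ordinary bisimilarity of the tree of histories under successor and the two indistinguishability
  relations.  Histories are words, compared letter by letter, so alternating the two relations
  rewrites words of a fixed but arbitrary length.  Let the letters carry, in unary along the word,
  the registers of a machine before and after a step, agent 0 seeing the configuration before and
  agent 1 the one after.  The connected component of a word is then the set of configurations
  linked to it by steps in either direction, and since the machine is deterministic it contains an
  accepting configuration only if the machine accepts from there.  The two games
  differ in how the words spelling the input end: in the first they end in a state that is linked
  to the computation, in the second in an isolated one.  Only a component with an accepting
  configuration, whose words end in a differently labelled state, reveals the difference, so the
  games are bisimilar iff the machine rejects.

  If bisimilarity were decidable, a machine could compute the codes of its own two games from its
  input and accept iff they are bisimilar.  No universal machine is needed: the input is a tuple of
  constants describing the part of the games that does not depend on it, and the remaining part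
  enters the codes through bounded sums.
\<close>

section \<open>Bounded arithmetic is computable\<close>

datatype expr =
    Var nat
  | Const nat
  | Plus expr expr
  | Times expr expr
  | Pow2 expr
  | Pair expr expr
  | Equal expr expr
  | Sum expr expr

fun eval_expr :: "expr \<Rightarrow> nat list \<Rightarrow> nat" where
  "eval_expr (Var i) xs = xs ! i"
| "eval_expr (Const c) xs = c"
| "eval_expr (Plus a b) xs = eval_expr a xs + eval_expr b xs"
| "eval_expr (Times a b) xs = eval_expr a xs * eval_expr b xs"
| "eval_expr (Pow2 a) xs = 2 ^ eval_expr a xs"
| "eval_expr (Pair a b) xs = prod_encode (eval_expr a xs, eval_expr b xs)"
| "eval_expr (Equal a b) xs = of_bool (eval_expr a xs = eval_expr b xs)"
| "eval_expr (Sum a b) xs = (\<Sum>j<eval_expr a xs. eval_expr b (j # xs))"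

fun scoped :: "nat \<Rightarrow> expr \<Rightarrow> bool" where
  "scoped n (Var i) \<longleftrightarrow> i < n"
| "scoped n (Const c) \<longleftrightarrow> True"
| "scoped n (Plus a b) \<longleftrightarrow> scoped n a \<and> scoped n b"
| "scoped n (Times a b) \<longleftrightarrow> scoped n a \<and> scoped n b"
| "scoped n (Pow2 a) \<longleftrightarrow> scoped n a"
| "scoped n (Pair a b) \<longleftrightarrow> scoped n a \<and> scoped n b"
| "scoped n (Equal a b) \<longleftrightarrow> scoped n a \<and> scoped n b"
| "scoped n (Sum a b) \<longleftrightarrow> scoped n a \<and> scoped (Suc n) b"

lemma evaluates_Comp1:
  "evaluates g xs y \<Longrightarrow> evaluates f [y] z \<Longrightarrow> evaluates (Comp f [g]) xs z"
  by (rule evaluates.Comp[of _ _ "[y]"]) auto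

lemma evaluates_Comp2:
  "evaluates g xs y \<Longrightarrow> evaluates g' xs y' \<Longrightarrow> evaluates f [y, y'] z \<Longrightarrow>
    evaluates (Comp f [g, g']) xs z"
  by (rule evaluates.Comp[of _ _ "[y, y']"]) auto

lemma evaluates_Proj': "i < length xs \<Longrightarrow> y = xs ! i \<Longrightarrow> evaluates (Proj i) xs y"
  by (simp add: evaluates.Proj)

lemma evaluates_Prim_Rec:
  assumes "evaluates f xs (F 0)" "\<And>k. evaluates g (k # F k # xs) (F (Suc k))"
  shows "evaluates (Prim_Rec f g) (n # xs) (F n)"
  by (induction n) (auto intro: evaluates.Prim_Rec_0 evaluates.Prim_Rec_Suc assms)

lemma const_evaluates: "\<exists>r. \<forall>xs. evaluates r xs c"
proof (induction c)
  case (Suc c)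
  then obtain r where "\<forall>xs. evaluates r xs c" by blast
  then have "\<forall>xs. evaluates (Comp Succ [r]) xs (Suc c)"
    by (meson evaluates_Comp1 evaluates.Succ)
  then show ?case by blast
qed (blast intro: evaluates.Zero)

lemma plus_evaluates: "\<exists>r. \<forall>x y. evaluates r [x, y] (x + y)"
proof (intro exI allI)
  show "evaluates (Prim_Rec (Proj 0) (Comp Succ [Proj 1])) [x, y] (x + y)" for x y
    by (rule evaluates_Prim_Rec[where F = "\<lambda>x. x + y"])
      (auto intro!: evaluates_Proj' evaluates_Comp1 evaluates.Succ)
qed

lemma times_evaluates: "\<exists>r. \<forall>x y. evaluates r [x, y] (x * y)"
proof -
  obtain p where p: "\<forall>x y. evaluates p [x, y] (x + y)" using plus_evaluates by blast
  show ?thesis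
  proof (intro exI allI)
    show "evaluates (Prim_Rec Zero (Comp p [Proj 2, Proj 1])) [x, y] (x * y)" for x y
      by (rule evaluates_Prim_Rec[where F = "\<lambda>x. x * y"])
        (auto intro!: evaluates.Zero evaluates_Proj' evaluates_Comp2[OF _ _ p[rule_format]])
  qed
qed

lemma pow2_evaluates: "\<exists>r. \<forall>x. evaluates r [x] (2 ^ x)"
proof -
  obtain p where p: "\<forall>x y. evaluates p [x, y] (x + y)" using plus_evaluates by blast
  obtain one where one: "\<forall>xs. evaluates one xs 1" using const_evaluates by blast
  have "evaluates (Comp p [Proj 1, Proj 1]) [k, 2 ^ k] (2 ^ Suc k)" for k
    using evaluates_Comp2[OF evaluates_Proj' evaluates_Proj' p[rule_format]]
    by (metis (no_types, lifting) One_nat_def lessI list.size(3,4) mult_2 nth_Cons_0 nth_Cons_Suc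
        power_Suc plus_1_eq_Suc add.commute)
  then have "evaluates (Prim_Rec one (Comp p [Proj 1, Proj 1])) [x] (2 ^ x)" for x
    by (intro evaluates_Prim_Rec[where F = "\<lambda>x. 2 ^ x"]) (auto simp: one[simplified])
  then show ?thesis by blast
qed

lemma prod_encode_evaluates: "\<exists>r. \<forall>x y. evaluates r [x, y] (prod_encode (x, y))"
proof -
  obtain p where p: "\<forall>x y. evaluates p [x, y] (x + y)" using plus_evaluates by blast
  have "evaluates (Comp p [Proj 1, Comp Succ [Proj 0]]) [k, triangle k] (triangle (Suc k))" for k
    unfolding triangle_Suc
    by (rule evaluates_Comp2[OF evaluates_Proj' evaluates_Comp1[OF evaluates_Proj' evaluates.Succ]
          p[rule_format]]) auto
  then have t: "evaluates (Prim_Rec Zero (Comp p [Proj 1, Comp Succ [Proj 0]])) [x] (triangle x)"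
    for x
    by (intro evaluates_Prim_Rec[where F = triangle]) (auto intro: evaluates.Zero)
  have "evaluates (Comp p [Comp (Prim_Rec Zero (Comp p [Proj 1, Comp Succ [Proj 0]])) [p], Proj 0])
      [x, y] (prod_encode (x, y))" for x y
    unfolding prod_encode_def prod.case
    by (rule evaluates_Comp2[OF evaluates_Comp1[OF p[rule_format] t] evaluates_Proj'
          p[rule_format]]) auto
  then show ?thesis by blast
qed

lemma equal_evaluates: "\<exists>r. \<forall>x y. evaluates r [x, y] (of_bool (x = y))"
proof -
  obtain p where p: "\<forall>x y. evaluates p [x, y] (x + y)" using plus_evaluates by blast
  obtain one where one: "\<forall>xs. evaluates one xs 1" using const_evaluates by blast
  have pred: "evaluates (Prim_Rec Zero (Proj 0)) [x] (x - 1)" for x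
    by (rule evaluates_Prim_Rec[where F = "\<lambda>x. x - 1"])
      (auto intro: evaluates.Zero intro!: evaluates_Proj')
  have "evaluates (Comp (Prim_Rec Zero (Proj 0)) [Proj 1]) [k, x - k, x] (x - Suc k)" for k x
    using evaluates_Comp1[OF evaluates_Proj' pred, of 1 "[k, x - k, x]" "x - k"] by simp
  then have minus:
    "evaluates (Prim_Rec (Proj 0) (Comp (Prim_Rec Zero (Proj 0)) [Proj 1])) [y, x] (x - y)"
    (is "evaluates ?m _ _") for x y
    by (rule evaluates_Prim_Rec[where F = "\<lambda>y. x - y", rotated]) (simp add: evaluates_Proj')
  have isz: "evaluates (Prim_Rec one Zero) [x] (of_bool (x = 0))" for x
    by (rule evaluates_Prim_Rec[where F = "\<lambda>x. of_bool (x = 0)"])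
      (auto intro: evaluates.Zero simp: one[simplified])
  have "evaluates (Comp (Prim_Rec one Zero) [Comp p [?m, Comp ?m [Proj 1, Proj 0]]]) [x, y]
      (of_bool ((y - x) + (x - y) = 0))" for x y
    by (rule evaluates_Comp1[OF evaluates_Comp2[OF minus evaluates_Comp2[OF evaluates_Proj'
            evaluates_Proj' minus] p[rule_format]] isz]) auto
  moreover have "(y - x) + (x - y) = 0 \<longleftrightarrow> x = y" for x y :: nat by auto
  ultimately show ?thesis unfolding of_bool_def by (simp only:) blast
qed

lemma list_all2_Proj:
  assumes "m = length ys" "n = length ys + length xs"
  shows "list_all2 (\<lambda>g y. evaluates g (ys @ xs) y) (map Proj [m..<n]) xs"
  using assms by (auto simp: list_all2_conv_all_nth nth_append intro!: evaluates_Proj')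

lemma expr_evaluates:
  "scoped n e \<Longrightarrow> \<exists>r. \<forall>xs. length xs = n \<longrightarrow> evaluates r xs (eval_expr e xs)"
proof (induction e arbitrary: n)
  case (Var i)
  then show ?case by (auto intro: evaluates.Proj)
next
  case (Const c)
  obtain r where "\<forall>xs. evaluates r xs c" using const_evaluates by blast
  then show ?case by auto
next
  case (Plus a b)
  then obtain r s where
    "\<forall>xs. length xs = n \<longrightarrow> evaluates r xs (eval_expr a xs)"
    "\<forall>xs. length xs = n \<longrightarrow> evaluates s xs (eval_expr b xs)"
    by fastforce
  moreover obtain p where "\<forall>x y. evaluates p [x, y] (x + y)"
    using plus_evaluates by blast
  ultimately have "\<forall>xs. length xs = n \<longrightarrow> evaluates (Comp p [r, s]) xs (eval_expr (Plus a b) xs)"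
    by (auto intro: evaluates_Comp2)
  then show ?case by blast
next
  case (Times a b)
  then obtain r s where
    "\<forall>xs. length xs = n \<longrightarrow> evaluates r xs (eval_expr a xs)"
    "\<forall>xs. length xs = n \<longrightarrow> evaluates s xs (eval_expr b xs)"
    by fastforce
  moreover obtain p where "\<forall>x y. evaluates p [x, y] (x * y)"
    using times_evaluates by blast
  ultimately have "\<forall>xs. length xs = n \<longrightarrow> evaluates (Comp p [r, s]) xs (eval_expr (Times a b) xs)"
    by (auto intro: evaluates_Comp2)
  then show ?case by blast
next
  case (Pow2 a)
  then obtain r where "\<forall>xs. length xs = n \<longrightarrow> evaluates r xs (eval_expr a xs)"
    by fastforce
  moreover obtain p where "\<forall>x. evaluates p [x] (2 ^ x)"
    using pow2_evaluates by blast
  ultimately have "\<forall>xs. length xs = n \<longrightarrow> evaluates (Comp p [r]) xs (eval_expr (Pow2 a) xs)"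
    by (auto intro: evaluates_Comp1)
  then show ?case by blast
next
  case (Pair a b)
  then obtain r s where
    "\<forall>xs. length xs = n \<longrightarrow> evaluates r xs (eval_expr a xs)"
    "\<forall>xs. length xs = n \<longrightarrow> evaluates s xs (eval_expr b xs)"
    by fastforce
  moreover obtain p where "\<forall>x y. evaluates p [x, y] (prod_encode (x, y))"
    using prod_encode_evaluates by blast
  ultimately have "\<forall>xs. length xs = n \<longrightarrow> evaluates (Comp p [r, s]) xs (eval_expr (Pair a b) xs)"
    by (auto intro: evaluates_Comp2)
  then show ?case by blast
next
  case (Equal a b)
  then obtain r s where
    "\<forall>xs. length xs = n \<longrightarrow> evaluates r xs (eval_expr a xs)"
    "\<forall>xs. length xs = n \<longrightarrow> evaluates s xs (eval_expr b xs)"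
    by fastforce
  moreover obtain p where "\<forall>x y. evaluates p [x, y] (of_bool (x = y))"
    using equal_evaluates by blast
  ultimately have "\<forall>xs. length xs = n \<longrightarrow> evaluates (Comp p [r, s]) xs (eval_expr (Equal a b) xs)"
    unfolding eval_expr.simps by (blast intro: evaluates_Comp2)
  then show ?case by blast
next
  case (Sum a b)
  obtain p where p: "\<forall>x y. evaluates p [x, y] (x + y)" using plus_evaluates by blast
  obtain ra where ra: "\<And>xs. length xs = n \<Longrightarrow> evaluates ra xs (eval_expr a xs)"
    using Sum.IH(1) Sum.prems by fastforce
  obtain rb where rb: "\<And>xs. length xs = Suc n \<Longrightarrow> evaluates rb xs (eval_expr b xs)"
    using Sum.IH(2)[of "Suc n"] Sum.prems by fastforce
  define g where "g = Comp p [Proj 1, Comp rb (Proj 0 # map Proj [2..<n + 2])]"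
  have "evaluates (Comp (Prim_Rec Zero g) (ra # map Proj [0..<n])) xs (eval_expr (Sum a b) xs)"
    if n: "length xs = n" for xs
  proof (rule evaluates.Comp)
    show "list_all2 (\<lambda>g y. evaluates g xs y) (ra # map Proj [0..<n]) (eval_expr a xs # xs)"
      using ra n list_all2_Proj[of 0 "[]" n xs] by simp
    have "evaluates g (k # y # xs) (y + eval_expr b (k # xs))" for k y
      unfolding g_def
    proof (rule evaluates_Comp2[OF _ _ p[rule_format]])
      show "evaluates (Proj 1) (k # y # xs) y" by (auto intro!: evaluates_Proj')
      show "evaluates (Comp rb (Proj 0 # map Proj [2..<n + 2])) (k # y # xs) (eval_expr b (k # xs))"
        by (rule evaluates.Comp[OF _ rb, of _ _ "k # xs"])
          (use n list_all2_Proj[of 2 "[k, y]" "n + 2" xs] in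
            \<open>auto simp del: upt_Suc intro!: evaluates_Proj'\<close>)
    qed
    then show "evaluates (Prim_Rec Zero g) (eval_expr a xs # xs) (eval_expr (Sum a b) xs)"
      unfolding eval_expr.simps
      by (intro evaluates_Prim_Rec[where F = "\<lambda>m. \<Sum>j<m. eval_expr b (j # xs)"])
        (auto intro: evaluates.Zero)
  qed
  then show ?case by blast
qed

lemma prod_decode_evaluates:
  shows "\<exists>r. \<forall>a b. evaluates r [prod_encode (a, b)] a"
    and "\<exists>r. \<forall>a b. evaluates r [prod_encode (a, b)] b"
proof -
  have search: "eval_expr (Sum (Plus (Var 0) (Const 1)) (Sum (Plus (Var 1) (Const 1))
      (Times (Equal (Pair (Var 1) (Var 0)) (Var 2)) (Var c)))) [prod_encode (a, b)] = [b, a] ! c"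
    if "c < 2" for a b c
  proof -
    let ?z = "prod_encode (a, b)"
    have le: "a \<le> ?z" "b \<le> ?z" by (auto intro: le_prod_encode_1 le_prod_encode_2)
    have "(\<Sum>i<?z + 1. \<Sum>j<?z + 1. of_bool (i = a \<and> j = b) * [j, i] ! c)
        = (\<Sum>i<?z + 1. \<Sum>j<?z + 1. if j = b then (if i = a then [b, a] ! c else 0) else 0)"
      by (intro sum.cong refl) auto
    also have "\<dots> = (\<Sum>i<?z + 1. if i = a then [b, a] ! c else 0)"
      using le by (intro sum.cong refl) (simp add: sum.delta)
    also have "\<dots> = [b, a] ! c" using le by (simp add: sum.delta)
    also have "(\<Sum>i<?z + 1. \<Sum>j<?z + 1. of_bool (i = a \<and> j = b) * [j, i] ! c) =
       (\<Sum>i<?z + 1. \<Sum>j<?z + 1. of_bool (i = a \<and> j = b) * [j, i, ?z] ! c)"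
      using that by (intro sum.cong refl) (auto simp: less_Suc_eq numeral_2_eq_2)
    finally show ?thesis by simp
  qed
  have "\<exists>r. \<forall>a b. evaluates r [prod_encode (a, b)] ([b, a] ! c)" if c: "c < 2" for c
  proof -
    obtain r where "\<forall>xs. length xs = 1 \<longrightarrow> evaluates r xs (eval_expr (Sum (Plus (Var 0) (Const 1))
        (Sum (Plus (Var 1) (Const 1)) (Times (Equal (Pair (Var 1) (Var 0)) (Var 2)) (Var c)))) xs)"
      using expr_evaluates[of 1 "Sum (Plus (Var 0) (Const 1)) (Sum (Plus (Var 1) (Const 1))
        (Times (Equal (Pair (Var 1) (Var 0)) (Var 2)) (Var c)))"] c by auto
    then have "\<forall>a b. evaluates r [prod_encode (a, b)] ([b, a] ! c)"
      using search[OF c] by (metis One_nat_def length_Cons list.size(3))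
    then show ?thesis by blast
  qed
  from this[of 1] this[of 0] show "\<exists>r. \<forall>a b. evaluates r [prod_encode (a, b)] a"
    "\<exists>r. \<forall>a b. evaluates r [prod_encode (a, b)] b"
    by simp_all
qed

section \<open>A language of register programs\<close>

datatype instr = Nop | Copy nat nat | Inc nat | Dec nat | IsZero nat

text \<open>\<open>Dec j\<close> is blocked, not idle, when the register \<open>j\<close> is zero.\<close>

fun effect :: "instr \<Rightarrow> (nat \<Rightarrow> nat) \<Rightarrow> (nat \<Rightarrow> nat) \<Rightarrow> bool" where
  "effect Nop v w \<longleftrightarrow> w = v"
| "effect (Copy j k) v w \<longleftrightarrow> w = v(j := v k)"
| "effect (Inc j) v w \<longleftrightarrow> w = v(j := Suc (v j))"
| "effect (Dec j) v w \<longleftrightarrow> v j > 0 \<and> w = v(j := v j - 1)"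
| "effect (IsZero j) v w \<longleftrightarrow> v j = 0 \<and> w = v"

fun registers :: "instr \<Rightarrow> nat set" where
  "registers Nop = {}"
| "registers (Copy j k) = {j, k}"
| "registers (Inc j) = {j}"
| "registers (Dec j) = {j}"
| "registers (IsZero j) = {j}"

datatype com = Skip | Instr instr | Seq com com | While nat com

inductive small :: "com \<Rightarrow> instr \<Rightarrow> com \<Rightarrow> bool" where
  "small (Instr i) i Skip"
| "small (Seq Skip c) Nop c"
| "small c i c' \<Longrightarrow> small (Seq c d) i (Seq c' d)"
| "small (While j c) (IsZero j) Skip"
| "small (While j c) (Dec j) (Seq c (While j c))"

inductive_cases small_elims:
  "small Skip i d"
  "small (Instr k) i d"
  "small (Seq c c') i d"
  "small (While j c) i d"

lemma small_deterministic:
  assumes "small c i d" "small c i' d'" "effect i v w" "effect i' v w'"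
  shows "d = d' \<and> w = w'"
  using assms
proof (induction arbitrary: i' d' rule: small.induct)
  case (1 i)
  then show ?case by (cases i) (auto elim!: small_elims)
next
  case (3 c i c' d)
  from 3(3) show ?case
    by (rule small_elims(3)) (use 3 in \<open>auto elim: small_elims\<close>)
qed (auto elim!: small_elims)

lemma finite_small: "finite {(i, d). small c i d}"
proof (induction c)
  case Skip
  have "{(i, d). small Skip i d} = {}" by (auto elim: small_elims)
  then show ?case by simp
next
  case (Instr k)
  have "{(i, d). small (Instr k) i d} \<subseteq> {(k, Skip)}" by (auto elim: small_elims)
  then show ?case by (rule finite_subset) simp
next
  case (Seq c d)
  have "{(i, e). small (Seq c d) i e} \<subseteq>
      insert (Nop, d) ((\<lambda>(i, c'). (i, Seq c' d)) ` {(i, c'). small c i c'})"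
    by (auto elim!: small_elims)
  then show ?case by (rule finite_subset) (use Seq in simp)
next
  case (While j c)
  have "{(i, d). small (While j c) i d} \<subseteq> {(IsZero j, Skip), (Dec j, Seq c (While j c))}"
    by (auto elim: small_elims)
  then show ?case by (rule finite_subset) simp
qed

fun derivatives :: "com \<Rightarrow> com set" where
  "derivatives Skip = {Skip}"
| "derivatives (Instr i) = {Instr i, Skip}"
| "derivatives (Seq c d) = (\<lambda>c'. Seq c' d) ` derivatives c \<union> derivatives d"
| "derivatives (While j c) = insert (While j c) (insert Skip ((\<lambda>c'. Seq c' (While j c)) ` derivatives c))"

lemma finite_derivatives: "finite (derivatives c)"
  by (induction c) auto

lemma self_derivative: "c \<in> derivatives c"
  by (induction c) auto

lemma small_derivatives: "c' \<in> derivatives c \<Longrightarrow> small c' i d \<Longrightarrow> d \<in> derivatives c"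
proof (induction c arbitrary: c' i d)
  case (Seq c1 c2)
  then show ?case by (auto elim!: small_elims(3) simp: self_derivative)
next
  case (While j c)
  then show ?case by (auto elim!: small_elims(3,4) elim: small_elims simp: self_derivative)
qed (auto elim: small_elims)

definition small_step :: "com \<times> (nat \<Rightarrow> nat) \<Rightarrow> com \<times> (nat \<Rightarrow> nat) \<Rightarrow> bool" where
  "small_step = (\<lambda>(c, v) (d, w). \<exists>i. small c i d \<and> effect i v w)"

definition runs :: "com \<Rightarrow> (nat \<Rightarrow> nat) \<Rightarrow> (nat \<Rightarrow> nat) \<Rightarrow> bool" where
  "runs c v w \<longleftrightarrow> small_step\<^sup>*\<^sup>* (c, v) (Skip, w)"

lemma runs_Skip: "runs Skip v v"
  by (simp add: runs_def)

lemma runs_Instr: "effect i v w \<Longrightarrow> runs (Instr i) v w"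
  unfolding runs_def by (rule r_into_rtranclp) (auto simp: small_step_def intro: small.intros)

lemma small_steps_Seq:
  "small_step\<^sup>*\<^sup>* (c, v) (c', w) \<Longrightarrow> small_step\<^sup>*\<^sup>* (Seq c d, v) (Seq c' d, w)"
proof (induction rule: rtranclp_induct2)
  case (step c' w c'' u)
  then have "small_step (Seq c' d, w) (Seq c'' d, u)"
    by (auto simp: small_step_def intro: small.intros)
  with step.IH show ?case by simp
qed simp

lemma runs_Seq:
  assumes "runs c v w" "runs d w u"
  shows "runs (Seq c d) v u"
proof -
  have "small_step (Seq Skip d, w) (d, w)"
    unfolding small_step_def by (auto intro!: exI[of _ Nop] small.intros)
  with small_steps_Seq[OF assms(1)[unfolded runs_def], of d] assms(2) show ?thesis
    unfolding runs_def by (meson converse_rtranclp_into_rtranclp rtranclp_trans)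
qed

lemma runs_While_zero: "v j = 0 \<Longrightarrow> runs (While j c) v v"
  unfolding runs_def
  by (rule r_into_rtranclp) (auto simp: small_step_def intro!: exI[of _ "IsZero j"] small.intros)

lemma runs_While_Suc:
  assumes "v j = Suc n" "runs c (v(j := n)) w" "runs (While j c) w u"
  shows "runs (While j c) v u"
proof -
  have "small_step (While j c, v) (Seq c (While j c), v(j := n))"
    using assms(1) by (auto simp: small_step_def intro!: exI[of _ "Dec j"] small.intros)
  from converse_rtranclp_into_rtranclp[OF this runs_Seq[OF assms(2,3), unfolded runs_def]]
  show ?thesis unfolding runs_def .
qed

lemma runs_clear: "runs (While j Skip) v (v(j := 0))"
proof (induction "v j" arbitrary: v)
  case 0
  then show ?case using runs_While_zero[of v j] by (simp add: fun_upd_idem)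
next
  case (Suc n)
  have "runs (While j Skip) (v(j := n)) (v(j := 0))"
    using Suc(1)[of "v(j := n)"] by simp
  then show ?case
    by (rule runs_While_Suc[OF Suc(2)[symmetric] runs_Skip[of "v(j := n)"]])
qed

primrec compile :: "recf \<Rightarrow> nat list \<Rightarrow> nat \<Rightarrow> nat \<Rightarrow> com"
  and compile_list :: "recf list \<Rightarrow> nat list \<Rightarrow> nat \<Rightarrow> nat \<Rightarrow> com" where
  "compile Zero as out m = While out Skip"
| "compile Succ as out m = Seq (Instr (Copy out (hd as))) (Instr (Inc out))"
| "compile (Proj i) as out m = Instr (Copy out (as ! i))"
| "compile (Comp f gs) as out m =
    Seq (compile_list gs as m (m + length gs)) (compile f [m..<m + length gs] out (m + length gs))"
| "compile (Prim_Rec f g) as out m =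
    Seq (compile f (tl as) out (m + 3)) (Seq (While m Skip) (Seq (Instr (Copy (m + 1) (hd as)))
      (While (m + 1) (Seq (compile g (m # out # tl as) (m + 2) (m + 3))
        (Seq (Instr (Copy out (m + 2))) (Instr (Inc m)))))))"
| "compile (Mu f) as out m =
    Seq (While out Skip) (Seq (compile f (out # as) m (m + 1))
      (While m (Seq (Instr (Inc out)) (compile f (out # as) m (m + 1)))))"
| "compile_list [] as t m = Skip"
| "compile_list (g # gs) as t m = Seq (compile g as t m) (compile_list gs as (Suc t) m)"

definition agree :: "nat \<Rightarrow> nat \<Rightarrow> (nat \<Rightarrow> nat) \<Rightarrow> (nat \<Rightarrow> nat) \<Rightarrow> bool" where
  "agree m out v w \<longleftrightarrow> (\<forall>j<m. j \<noteq> out \<longrightarrow> w j = v j)"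

lemma agree_map:
  assumes "agree m out v w" "\<forall>a\<in>set as. a < m" "out \<notin> set as"
  shows "map w as = map v as"
  using assms unfolding agree_def by (metis map_cong)

definition computes :: "recf \<Rightarrow> bool" where
  "computes r \<longleftrightarrow> (\<forall>as out m v y.
    evaluates r (map v as) y \<longrightarrow> (\<forall>a\<in>set as. a < m) \<longrightarrow> out < m \<longrightarrow> out \<notin> set as \<longrightarrow>
      (\<exists>w. runs (compile r as out m) v w \<and> w out = y \<and> agree m out v w))"

lemma computesE:
  assumes "computes r" "evaluates r (map v as) y" "\<forall>a\<in>set as. a < m" "out < m" "out \<notin> set as"
  obtains w where "runs (compile r as out m) v w" "w out = y" "agree m out v w"
  using assms unfolding computes_def by metis

lemma compile_list_computes:
  assumes "\<forall>g\<in>set gs. computes g" "list_all2 (\<lambda>g y. evaluates g (map v as) y) gs ys"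
    "\<forall>a\<in>set as. a < t" "t + length gs \<le> m"
  shows "\<exists>w. runs (compile_list gs as t m) v w \<and> map w [t..<t + length gs] = ys \<and> (\<forall>j<t. w j = v j)"
  using assms
proof (induction gs arbitrary: ys t v)
  case Nil
  then show ?case by (auto intro: runs_Skip)
next
  case (Cons g gs)
  from Cons.prems(2) obtain y ys' where
    ys: "ys = y # ys'" "evaluates g (map v as) y" "list_all2 (\<lambda>g y. evaluates g (map v as) y) gs ys'"
    by (auto simp: list_all2_Cons1)
  have as: "\<forall>a\<in>set as. a < m" "t \<notin> set as" "t < m" using Cons.prems(3,4) by auto
  from Cons.prems(1) have "computes g" by simp
  then obtain w where w: "runs (compile g as t m) v w" "w t = y" "agree m t v w"
    by (rule computesE[OF _ ys(2) as(1,3,2)])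
  have "list_all2 (\<lambda>g y. evaluates g (map w as) y) gs ys'"
    unfolding agree_map[OF w(3) as(1,2)] by (rule ys(3))
  with Cons.prems have "\<exists>u. runs (compile_list gs as (Suc t) m) w u \<and>
      map u [Suc t..<Suc t + length gs] = ys' \<and> (\<forall>j<Suc t. u j = w j)"
    by (intro Cons.IH) (auto simp: less_Suc_eq)
  then obtain u where u: "runs (compile_list gs as (Suc t) m) w u"
    "map u [Suc t..<Suc t + length gs] = ys'" "\<forall>j<Suc t. u j = w j"
    by blast
  have "map u [t..<t + length (g # gs)] = ys"
    using u(2,3) w(2) ys(1) by (simp add: upt_conv_Cons del: upt_Suc)
  moreover have "\<forall>j<t. u j = v j" using u(3) w(3) as(3) by (auto simp: agree_def)
  ultimately show ?case using runs_Seq[OF w(1) u(1)] by auto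
qed

lemma Prim_Rec_trace:
  assumes "evaluates (Prim_Rec f g) (n # xs) y"
  shows "\<exists>F. evaluates f xs (F 0) \<and> (\<forall>k<n. evaluates g (k # F k # xs) (F (Suc k))) \<and> F n = y"
  using assms
proof (induction n arbitrary: y)
  case 0
  then show ?case by (auto elim: evaluates_elims(5))
next
  case (Suc n)
  then obtain z where z: "evaluates (Prim_Rec f g) (n # xs) z" "evaluates g (n # z # xs) y"
    by (elim evaluates_elims(6))
  with Suc.IH obtain F where
    F: "evaluates f xs (F 0)" "\<forall>k<n. evaluates g (k # F k # xs) (F (Suc k))" "F n = z"
    by blast
  then show ?case
    using z(2) by (intro exI[of _ "F(Suc n := y)"]) (auto simp: less_Suc_eq)
qed

lemma Prim_Rec_loop:
  assumes g: "computes g" and as: "\<forall>a\<in>set as. a < m" "out < m" "out \<notin> set as"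
    and F: "\<forall>k<n. evaluates g (k # F k # xs) (F (Suc k))"
    and v: "map v as = xs" "k \<le> n" "v m = k" "v (m + 1) = n - k" "v out = F k"
  shows "\<exists>w. runs (While (m + 1) (Seq (compile g (m # out # as) (m + 2) (m + 3))
      (Seq (Instr (Copy out (m + 2))) (Instr (Inc m))))) v w \<and> w out = F n \<and> agree m out v w"
    (is "\<exists>w. runs ?loop v w \<and> _ w \<and> _ w")
  using v
proof (induction "n - k" arbitrary: v k)
  case 0
  then show ?case by (intro exI[of _ v]) (auto intro: runs_While_zero simp: agree_def)
next
  case (Suc d)
  let ?u = "v(m + 1 := d)"
  have u: "map ?u (m # out # as) = k # F k # xs"
    using Suc.prems as by (auto intro!: map_cong[OF refl])
  have "evaluates g (map ?u (m # out # as)) (F (Suc k))"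
    unfolding u using F Suc by simp
  then obtain w where w: "runs (compile g (m # out # as) (m + 2) (m + 3)) ?u w"
    "w (m + 2) = F (Suc k)" "agree (m + 3) (m + 2) ?u w"
    by (rule computesE[OF g, where m = "m + 3" and out = "m + 2"]) (use as in auto)
  let ?w = "w(out := F (Suc k))"
  let ?w' = "?w(m := Suc k)"
  have old: "w j = ?u j" if "j < m + 2" for j using w(3) that by (auto simp: agree_def)
  have "\<exists>x. runs ?loop ?w' x \<and> x out = F n \<and> agree m out ?w' x"
  proof (rule Suc.hyps(1))
    show "map ?w' as = xs" using as old Suc.prems(1) by (auto intro!: map_cong[OF refl])
    show "?w' (m + 1) = n - Suc k" using old[of "m + 1"] as Suc.hyps by simp
  qed (use Suc.hyps as in auto)
  then obtain x where x: "runs ?loop ?w' x" "x out = F n" "agree m out ?w' x" by blast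
  have "runs (Instr (Copy out (m + 2))) w ?w" "runs (Instr (Inc m)) ?w ?w'"
    using w(2) old[of m] as Suc.prems by (auto intro!: runs_Instr simp: fun_eq_iff)
  from runs_While_Suc[OF _ runs_Seq[OF w(1) runs_Seq[OF this]] x(1)]
  have "runs ?loop v x" using Suc by simp
  moreover have "agree m out v x"
    using x(3) old by (auto simp: agree_def)
  ultimately show ?case using x(2) by blast
qed

lemma Mu_loop:
  assumes f: "computes f" and as: "\<forall>a\<in>set as. a < m" "out < m" "out \<notin> set as"
    and n: "evaluates f (n # xs) 0" "\<forall>k<n. \<exists>y. evaluates f (k # xs) (Suc y)"
    and v: "map v as = xs" "v out \<le> n" "evaluates f (v out # xs) (v m)"
  shows "\<exists>w. runs (While m (Seq (Instr (Inc out)) (compile f (out # as) m (m + 1)))) v w \<and>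
      w out = n \<and> agree m out v w"
    (is "\<exists>w. runs ?loop v w \<and> _ w \<and> _ w")
  using v
proof (induction "n - v out" arbitrary: v)
  case 0
  then have "v out = n" by simp
  with 0 n(1) have "v m = 0" using evaluates_deterministic by blast
  with \<open>v out = n\<close> show ?case
    by (intro exI[of _ v]) (auto intro: runs_While_zero simp: agree_def)
next
  case (Suc d)
  then have "v out < n" by simp
  with n(2) obtain y where y: "evaluates f (v out # xs) (Suc y)" by blast
  with Suc.prems(3) have vm: "v m = Suc y" using evaluates_deterministic by blast
  let ?u = "v(m := y, out := Suc (v out))"
  have u: "map ?u (out # as) = Suc (v out) # xs"
    using Suc.prems(1) as by (auto intro!: map_cong[OF refl])
  obtain z where z: "evaluates f (Suc (v out) # xs) z"
    using n \<open>v out < n\<close> by (metis Suc_lessI)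
  then have "evaluates f (map ?u (out # as)) z" unfolding u .
  then obtain w where w: "runs (compile f (out # as) m (m + 1)) ?u w" "w m = z" "agree (m + 1) m ?u w"
    by (rule computesE[OF f, where m = "m + 1" and out = m]) (use as in auto)
  have old: "w j = ?u j" if "j < m" for j using w(3) that by (auto simp: agree_def)
  have "\<exists>x. runs ?loop w x \<and> x out = n \<and> agree m out w x"
  proof (rule Suc.hyps(1))
    show "map w as = xs" using as old Suc.prems(1) by (auto intro!: map_cong[OF refl])
  qed (use Suc.hyps as old[of out] z w(2) \<open>v out < n\<close> in auto)
  then obtain x where x: "runs ?loop w x" "x out = n" "agree m out w x" by blast
  have "runs (Instr (Inc out)) (v(m := y)) ?u"
    using as by (auto intro!: runs_Instr)
  from runs_While_Suc[OF vm runs_Seq[OF this w(1)] x(1)]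
  have "runs ?loop v x" .
  moreover have "agree m out v x" using x(3) old by (auto simp: agree_def)
  ultimately show ?case using x(2) by blast
qed

lemma compile_computes: "computes r"
proof (induction r)
  case Zero
  show ?case unfolding computes_def
    by (auto elim!: evaluates_elims(1) intro!: exI runs_clear simp: agree_def)
next
  case Succ
  show ?case unfolding computes_def
  proof (intro allI impI)
    fix as :: "nat list" and out m v y
    assume "evaluates Succ (map v as) y" "\<forall>a\<in>set as. a < m" "out < m" "out \<notin> set as"
    moreover from this obtain a where "as = [a]" "y = Suc (v a)"
      by (auto elim!: evaluates_elims(2))
    ultimately show "\<exists>w. runs (compile Succ as out m) v w \<and> w out = y \<and> agree m out v w"
      using runs_Seq[OF runs_Instr[of "Copy out a" v "v(out := v a)"]
          runs_Instr[of "Inc out" _ "v(out := Suc (v a))"]]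
      by (intro exI[of _ "v(out := Suc (v a))"]) (auto simp: agree_def)
  qed
next
  case (Proj i)
  show ?case unfolding computes_def
    by (auto elim!: evaluates_elims(3) intro!: exI runs_Instr simp: agree_def)
next
  case (Comp f gs)
  show ?case unfolding computes_def
  proof (intro allI impI)
    fix as :: "nat list" and out m v y
    assume ev: "evaluates (Comp f gs) (map v as) y"
      and as: "\<forall>a\<in>set as. a < m" "out < m" "out \<notin> set as"
    from ev obtain ys where ys: "list_all2 (\<lambda>g y. evaluates g (map v as) y) gs ys" "evaluates f ys y"
      by (elim evaluates_elims(4))
    obtain w where w: "runs (compile_list gs as m (m + length gs)) v w"
      "map w [m..<m + length gs] = ys" "\<forall>j<m. w j = v j"
      using compile_list_computes[OF _ ys(1) as(1), of "m + length gs"] Comp.IH by auto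
    obtain u where u: "runs (compile f [m..<m + length gs] out (m + length gs)) w u" "u out = y"
      "agree (m + length gs) out w u"
      using computesE[OF Comp.IH(1), of w "[m..<m + length gs]" y "m + length gs" out] ys(2) as(2)
      by (auto simp: w(2))
    show "\<exists>w. runs (compile (Comp f gs) as out m) v w \<and> w out = y \<and> agree m out v w"
      using runs_Seq[OF w(1) u(1)] u(2,3) w(3) by (auto simp: agree_def)
  qed
next
  case (Prim_Rec f g)
  show ?case unfolding computes_def
  proof (intro allI impI)
    fix as :: "nat list" and out m v y
    assume ev: "evaluates (Prim_Rec f g) (map v as) y"
      and as: "\<forall>a\<in>set as. a < m" "out < m" "out \<notin> set as"
    obtain a as' where a: "as = a # as'"
      using ev by (cases as) (auto elim: evaluates.cases)
    from ev Prim_Rec_trace[of f g "v a" "map v as'" y] obtain F where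
      F: "evaluates f (map v as') (F 0)"
        "\<forall>k<v a. evaluates g (k # F k # map v as') (F (Suc k))" "F (v a) = y"
      by (auto simp: a)
    obtain w where w: "runs (compile f as' out (m + 3)) v w" "w out = F 0" "agree (m + 3) out v w"
      by (rule computesE[OF Prim_Rec.IH(1) F(1), of "m + 3" out]) (use as a in auto)
    let ?u = "w(m := 0, m + 1 := v a)"
    have old: "w j = v j" if "j < m" "j \<noteq> out" for j using w(3) that by (auto simp: agree_def)
    have "\<exists>x. runs (While (m + 1) (Seq (compile g (m # out # as') (m + 2) (m + 3))
      (Seq (Instr (Copy out (m + 2))) (Instr (Inc m))))) ?u x \<and> x out = F (v a) \<and> agree m out ?u x"
      by (rule Prim_Rec_loop[where n = "v a" and F = F and xs = "map v as'" and k = 0, OF Prim_Rec.IH(2) _ _ _ F(2)])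
        (use as a w(2) old in \<open>auto intro!: map_cong[OF refl]\<close>)
    then obtain x where x: "runs (While (m + 1) (Seq (compile g (m # out # as') (m + 2) (m + 3))
      (Seq (Instr (Copy out (m + 2))) (Instr (Inc m))))) ?u x" "x out = y" "agree m out ?u x"
      using F(3) by auto
    have "runs (Instr (Copy (m + 1) a)) (w(m := 0)) ?u"
      using as old[of a] by (auto simp: a intro!: runs_Instr)
    from runs_Seq[OF w(1) runs_Seq[OF runs_clear runs_Seq[OF this x(1)]]]
    have "runs (compile (Prim_Rec f g) as out m) v x" by (simp add: a)
    moreover have "agree m out v x" using x(3) old by (auto simp: agree_def)
    ultimately show "\<exists>w. runs (compile (Prim_Rec f g) as out m) v w \<and> w out = y \<and> agree m out v w"
      using x(2) by blast
  qed
next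
  case (Mu f)
  show ?case unfolding computes_def
  proof (intro allI impI)
    fix as :: "nat list" and out m v n
    assume ev: "evaluates (Mu f) (map v as) n"
      and as: "\<forall>a\<in>set as. a < m" "out < m" "out \<notin> set as"
    from ev have n: "evaluates f (n # map v as) 0" "\<forall>k<n. \<exists>y. evaluates f (k # map v as) (Suc y)"
      by (auto elim: evaluates_elims(7))
    then obtain y where y: "evaluates f (0 # map v as) y" by (cases "n = 0") auto
    let ?u = "v(out := 0)"
    have m: "map ?u (out # as) = 0 # map v as" using as by (auto intro!: map_cong[OF refl])
    have "evaluates f (map ?u (out # as)) y" unfolding m by (rule y)
    then obtain w where w: "runs (compile f (out # as) m (m + 1)) ?u w" "w m = y" "agree (m + 1) m ?u w"
      by (rule computesE[OF Mu.IH, where m = "m + 1" and out = m]) (use as in auto)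
    have old: "w j = ?u j" if "j < m" for j using w(3) that by (auto simp: agree_def)
    have "\<exists>x. runs (While m (Seq (Instr (Inc out)) (compile f (out # as) m (m + 1)))) w x \<and>
        x out = n \<and> agree m out w x"
      by (rule Mu_loop[OF Mu.IH as n]) (use as old y w(2) in \<open>auto intro!: map_cong[OF refl]\<close>)
    then obtain x where x: "runs (While m (Seq (Instr (Inc out)) (compile f (out # as) m (m + 1)))) w x"
      "x out = n" "agree m out w x" by blast
    have "runs (compile (Mu f) as out m) v x"
      using runs_Seq[OF runs_clear runs_Seq[OF w(1) x(1)]] by simp
    moreover have "agree m out v x" using x(3) old by (auto simp: agree_def)
    ultimately show "\<exists>w. runs (compile (Mu f) as out m) v w \<and> w out = n \<and> agree m out v w"
      using x(2) by blast
  qed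
qed

section \<open>Games with a single action\<close>

definition idle :: "nat \<Rightarrow> nat" where
  "idle = (\<lambda>i\<in>{0, 1}. 0)"

lemma idle_simps [simp]: "idle 0 = 0" "idle 1 = 0" "idle (Suc 0) = 0"
  by (auto simp: idle_def)

lemma PiE_singleton_act: "({0, 1} \<rightarrow>\<^sub>E {0}) = {idle}"
proof -
  have "({0, 1} \<rightarrow>\<^sub>E {0}) = (\<Pi>\<^sub>E i\<in>{0, 1}. {idle i})" by (rule PiE_cong) auto
  also have "\<dots> = {idle}" by (rule PiE_singleton) (auto simp: idle_def extensional_def)
  finally show ?thesis .
qed

locale word_game =
  fixes enc :: "'s \<Rightarrow> nat" and S :: "'s set" and start :: 's
    and key :: "nat \<Rightarrow> 's \<Rightarrow> 's" and lab :: "'s \<Rightarrow> nat set"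
  assumes inj_enc: "inj enc" and start: "start \<in> S"
begin

definition game :: "('s \<Rightarrow> 's \<Rightarrow> bool) \<Rightarrow> nat_icgs" where
  "game E = \<lparr>agents = {0, 1}, states = enc ` S, init = enc start, acts = {0},
    indist = \<lambda>i. {(enc s, enc t) | s t. s \<in> S \<and> t \<in> S \<and> key i s = key i t},
    protocol = \<lambda>i s. {0},
    transitions = {(enc s, idle, enc t) | s t. E s t},
    label = \<lambda>n. lab (inv enc n)\<rparr>"

lemma game_sel [simp]:
  "agents (game E) = {0, 1}" "states (game E) = enc ` S" "init (game E) = enc start"
  "acts (game E) = {0}" "protocol (game E) i n = {0}" "label (game E) (enc s) = lab s"
  "(enc s, enc t) \<in> indist (game E) i \<longleftrightarrow> s \<in> S \<and> t \<in> S \<and> key i s = key i t"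
  using inj_enc by (auto simp: game_def dest: injD)

lemma joint_actions_game: "joint_actions (game E) = {idle}"
  by (simp only: joint_actions_def game_sel PiE_singleton_act)

lemma transitions_game: "transitions (game E) = {(enc s, idle, enc t) | s t. E s t}"
  by (simp add: game_def)

lemma transitions_game_enc:
  "(enc s, a, n) \<in> transitions (game E) \<longleftrightarrow> a = idle \<and> (\<exists>t. n = enc t \<and> E s t)"
  using inj_enc by (auto simp: transitions_game dest: injD)

definition edges_within :: "('s \<Rightarrow> 's \<Rightarrow> bool) \<Rightarrow> bool" where
  "edges_within E \<longleftrightarrow> (\<forall>s t. E s t \<longrightarrow> s \<in> S \<and> t \<in> S)"

lemma finite_icgs_game:
  assumes "finite S" "edges_within E" "\<And>s. s \<in> S \<Longrightarrow> \<exists>t. E s t"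
  shows "finite_icgs (game E)"
proof -
  have "equiv (states (game E)) (indist (game E) i)" for i
  proof (rule equivI)
    show "indist (game E) i \<subseteq> states (game E) \<times> states (game E)"
      by (auto simp: game_def)
    show "refl_on (states (game E)) (indist (game E) i)"
      by (auto simp: refl_on_def)
    show "sym (indist (game E) i)"
      by (force simp: game_def sym_def)
    show "trans (indist (game E) i)"
      using inj_enc by (auto simp: game_def trans_def dest!: injD) blast
  qed
  moreover have "(\<exists>t. (s, a, t) \<in> transitions (game E)) \<longleftrightarrow>
      (\<forall>i\<in>agents (game E). a i \<in> protocol (game E) i s)"
    if "s \<in> states (game E)" "a \<in> joint_actions (game E)" for s a
    using that assms(3) by (auto simp: joint_actions_game transitions_game_enc)
  moreover have "transitions (game E) \<subseteq> states (game E) \<times> joint_actions (game E) \<times> states (game E)"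
    using assms(2) by (auto simp: transitions_game joint_actions_game edges_within_def)
  ultimately show ?thesis
    using assms(1) start by (simp add: finite_icgs_def is_icgs_def)
qed

definition word :: "('s \<Rightarrow> 's \<Rightarrow> bool) \<Rightarrow> (nat \<Rightarrow> 's) \<Rightarrow> nat \<Rightarrow> bool" where
  "word E f n \<longleftrightarrow> f 0 = start \<and> (\<forall>p<n. E (f p) (f (Suc p)))"

primrec run :: "(nat \<Rightarrow> 's) \<Rightarrow> nat \<Rightarrow> (nat, nat, nat) run" where
  "run f 0 = Start (enc (f 0))"
| "run f (Suc n) = Step (run f n) idle (enc (f (Suc n)))"

lemma run_eq: "run f n = run g m \<longleftrightarrow> n = m \<and> (\<forall>p\<le>n. f p = g p)"
proof (induction n arbitrary: m)
  case 0
  then show ?case using inj_enc by (cases m) (auto dest: injD)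
next
  case (Suc n)
  then show ?case using inj_enc by (cases m) (auto dest: injD simp: le_Suc_eq)
qed

lemma last_state_run [simp]: "last_state (run f n) = enc (f n)"
  by (cases n) auto

lemma word_Suc: "word E f (Suc n) \<longleftrightarrow> word E f n \<and> E (f n) (f (Suc n))"
  by (auto simp: word_def less_Suc_eq)

lemma word_cong: "(\<And>p. p \<le> n \<Longrightarrow> f p = g p) \<Longrightarrow> word E f n = word E g n"
  by (auto simp: word_def)

lemma run_cong: "(\<And>p. p \<le> n \<Longrightarrow> f p = g p) \<Longrightarrow> run f n = run g n"
  by (simp add: run_eq)

lemma run_snoc: "run (f(Suc n := s)) (Suc n) = Step (run f n) idle (enc s)"
  using run_cong[of n "f(Suc n := s)" f] by simp

lemma word_snoc: "word E (f(Suc n := s)) (Suc n) \<longleftrightarrow> word E f n \<and> E (f n) s"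
  using word_cong[of n "f(Suc n := s)" f] by (simp add: word_Suc)

lemma word_in_S: "edges_within E \<Longrightarrow> word E f n \<Longrightarrow> p \<le> n \<Longrightarrow> f p \<in> S"
  using start by (cases p) (auto simp: word_def edges_within_def Suc_le_eq)

lemma run_in_hist: "word E f n \<Longrightarrow> run f n \<in> hist (game E)"
proof (induction n)
  case 0
  then show ?case using hist.Start[of "game E"] by (simp add: word_def)
next
  case (Suc n)
  then show ?case by (auto simp: word_Suc transitions_game_enc intro!: hist.Step)
qed

lemma hist_game: "hist (game E) = {run f n | f n. word E f n}"
proof (intro equalityI subsetI)
  fix h assume "h \<in> hist (game E)"
  then show "h \<in> {run f n | f n. word E f n}"
  proof induction
    case Start
    show ?case by (auto simp: word_def intro!: exI[of _ "\<lambda>_. start"] exI[of _ 0])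
  next
    case (Step h a s)
    then obtain f n t where "h = run f n" "word E f n" "a = idle" "s = enc t" "E (f n) t"
      by (auto simp: transitions_game_enc)
    then have "Step h a s = run (f(Suc n := t)) (Suc n)" "word E (f(Suc n := t)) (Suc n)"
      by (simp_all only: run_snoc word_snoc)
    then show ?case by blast
  qed
qed (auto intro: run_in_hist)

lemma run_indist_run:
  assumes "\<And>p. p \<le> n \<Longrightarrow> f p \<in> S" "\<And>p. p \<le> m \<Longrightarrow> g p \<in> S"
  shows "run_indist (game E) i (run f n) (run g m) \<longleftrightarrow>
    n = m \<and> (\<forall>p\<le>n. key i (f p) = key i (g p))"
  using assms
proof (induction n arbitrary: m)
  case 0
  then show ?case by (cases m) auto
next
  case (Suc n)
  show ?case
  proof (cases m)
    case (Suc m')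
    then show ?thesis using Suc.IH[of m'] Suc.prems by (auto simp: le_Suc_eq)
  qed simp
qed

lemma hist_indist_run:
  assumes "edges_within E" "word E f n"
  shows "(run f n, k) \<in> hist_indist (game E) i \<longleftrightarrow>
    (\<exists>g. word E g n \<and> k = run g n \<and> (\<forall>p\<le>n. key i (f p) = key i (g p)))"
proof -
  have S: "g p \<in> S" if "word E g m" "p \<le> m" for g m p
    using word_in_S[OF assms(1)] that by blast
  show ?thesis
  proof
    assume "(run f n, k) \<in> hist_indist (game E) i"
    then obtain g m where g: "k = run g m" "word E g m" "run_indist (game E) i (run f n) k"
      unfolding hist_indist_def hist_game by blast
    have "run_indist (game E) i (run f n) (run g m)"
      using g by simp
    then have "n = m \<and> (\<forall>p\<le>n. key i (f p) = key i (g p))"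
      by (subst (asm) run_indist_run) (auto intro: S assms(2) g(2))
    with g(1,2) show "\<exists>g. word E g n \<and> k = run g n \<and> (\<forall>p\<le>n. key i (f p) = key i (g p))"
      by blast
  next
    assume "\<exists>g. word E g n \<and> k = run g n \<and> (\<forall>p\<le>n. key i (f p) = key i (g p))"
    then obtain g where g: "word E g n" "k = run g n" "\<forall>p\<le>n. key i (f p) = key i (g p)" by blast
    then have "run_indist (game E) i (run f n) (run g n)"
      by (subst run_indist_run) (auto intro: S assms(2))
    with g assms(2) show "(run f n, k) \<in> hist_indist (game E) i"
      unfolding hist_indist_def by (auto intro: run_in_hist)
  qed
qed

lemma succs_run:
  assumes "\<sigma> \<in> pstr (game E) {0, 1} Q" "run f n \<in> Q" "word E f n"
  shows "succs (game E) {0, 1} (run f n) \<sigma> = {run (f(Suc n := t)) (Suc n) | t. E (f n) t}"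
proof -
  have "\<sigma> i (run f n) = Some 0" if "i \<in> {0, 1}" for i
  proof -
    have "dom (\<sigma> i) = Q" "\<forall>h\<in>Q. the (\<sigma> i h) \<in> protocol (game E) i (last_state h)"
      using assms(1) that unfolding pstr_def by blast+
    then have "run f n \<in> dom (\<sigma> i)" "the (\<sigma> i (run f n)) = 0"
      using assms(2) by auto
    then show ?thesis by auto
  qed
  then have "succs (game E) {0, 1} (run f n) \<sigma> =
      {Step (run f n) a s | a s. Step (run f n) a s \<in> hist (game E) \<and> (\<forall>i\<in>{0, 1}. a i = 0)}"
    by (auto simp: succs_def)
  also have "\<dots> = {Step (run f n) idle (enc t) | t. E (f n) t}"
  proof (intro equalityI subsetI; clarify)
    fix a s assume "Step (run f n) a s \<in> hist (game E)"
    then have "(enc (f n), a, s) \<in> transitions (game E)"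
      by (cases rule: hist.cases) auto
    then show "\<exists>t. Step (run f n) a s = Step (run f n) idle (enc t) \<and> E (f n) t"
      by (auto simp: transitions_game_enc)
  next
    fix t assume "E (f n) t"
    then have "Step (run f n) idle (enc t) \<in> hist (game E)"
      using run_in_hist[OF assms(3)] by (auto intro!: hist.Step simp: transitions_game_enc)
    then show "\<exists>a s. Step (run f n) idle (enc t) = Step (run f n) a s \<and>
        Step (run f n) a s \<in> hist (game E) \<and> (\<forall>i\<in>{0, 1}. a i = 0)"
      by (intro exI[of _ idle] exI[of _ "enc t"]) auto
  qed
  finally show ?thesis unfolding run_snoc .
qed

definition const_strat :: "(nat, nat, nat) run set \<Rightarrow> (nat, nat, nat) strat" where
  "const_strat Q = (\<lambda>i. if i \<in> {0, 1} then (\<lambda>h. if h \<in> Q then Some 0 else None) else Map.empty)"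

lemma const_strat_pstr: "const_strat Q \<in> pstr (game E) {0, 1} Q"
  by (auto simp: const_strat_def pstr_def dom_def)

lemma nbhd_refl: "h \<in> nbhd G A h"
  by (simp add: nbhd_def)

lemma simulationI:
  assumes E: "edges_within E1" "edges_within E2"
    and words: "\<And>f n g m. R f n g m \<Longrightarrow> word E1 f n \<and> word E2 g m \<and> lab (f n) = lab (g m)"
    and neighbour: "\<And>f n g m i g'. R f n g m \<Longrightarrow> i \<in> {0, 1} \<Longrightarrow> word E2 g' m \<Longrightarrow>
      \<forall>p\<le>m. key i (g p) = key i (g' p) \<Longrightarrow>
      \<exists>f'. word E1 f' n \<and> (\<forall>p\<le>n. key i (f p) = key i (f' p)) \<and> R f' n g' m"
    and successor: "\<And>f n g m t. R f n g m \<Longrightarrow> E2 (g m) t \<Longrightarrow>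
      \<exists>s. E1 (f n) s \<and> R (f(Suc n := s)) (Suc n) (g(Suc m := t)) (Suc m)"
  shows "simulation {0, 1} (game E1) (game E2) {(run f n, run g m) | f n g m. R f n g m}"
proof -
  let ?R = "{(run f n, run g m) | f n g m. R f n g m}"
  have "?R \<subseteq> hist (game E1) \<times> hist (game E2)"
    using words by (auto intro!: run_in_hist)
  moreover have "label (game E1) (last_state h) = label (game E2) (last_state h')"
    if "(h, h') \<in> ?R" for h h'
    using that words by auto
  moreover have "\<exists>k. (h, k) \<in> hist_indist (game E1) i \<and> (k, k') \<in> ?R"
    if "(h, h') \<in> ?R" "i \<in> {0, 1}" "(h', k') \<in> hist_indist (game E2) i" for h h' i k'
  proof -
    from that(1) obtain f n g m where R: "h = run f n" "h' = run g m" "R f n g m" by blast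
    with words have w: "word E1 f n" "word E2 g m" by blast+
    from that(3) obtain g' where "word E2 g' m" "k' = run g' m" "\<forall>p\<le>m. key i (g p) = key i (g' p)"
      unfolding R(2) hist_indist_run[OF E(2) w(2)] by blast
    with neighbour[OF R(3) that(2)] obtain f' where
      "word E1 f' n" "\<forall>p\<le>n. key i (f p) = key i (f' p)" "R f' n g' m" by blast
    then show ?thesis
      unfolding R(1) hist_indist_run[OF E(1) w(1)] using \<open>k' = run g' m\<close> by blast
  qed
  moreover have "\<exists>l\<in>succs (game E1) {0, 1} k \<sigma>. (l, l') \<in> ?R"
    if k: "k \<in> Q" "k' \<in> Q'" "(k, k') \<in> ?R" "\<sigma> \<in> pstr (game E1) {0, 1} Q"
      "l' \<in> succs (game E2) {0, 1} k' (const_strat Q')" for k k' Q Q' \<sigma> l'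
  proof -
    from k(3) obtain f n g m where R: "k = run f n" "k' = run g m" "R f n g m" by blast
    with words have w: "word E1 f n" "word E2 g m" by blast+
    from k(5) obtain t where t: "E2 (g m) t" "l' = run (g(Suc m := t)) (Suc m)"
      using succs_run[OF const_strat_pstr k(2)[unfolded R(2)] w(2)] R(2) by blast
    with successor[OF R(3)] show ?thesis
      unfolding R(1) succs_run[OF k(4) k(1)[unfolded R(1)] w(1)] by blast
  qed
  ultimately have *: "?R \<subseteq> hist (game E1) \<times> hist (game E2)"
    "\<And>h h'. (h, h') \<in> ?R \<Longrightarrow> label (game E1) (last_state h) = label (game E2) (last_state h')"
    "\<And>h h' i k'. (h, h') \<in> ?R \<Longrightarrow> i \<in> {0, 1} \<Longrightarrow> (h', k') \<in> hist_indist (game E2) i \<Longrightarrow>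
      \<exists>k. (h, k) \<in> hist_indist (game E1) i \<and> (k, k') \<in> ?R"
    "\<And>k k' Q Q' \<sigma> l'. k \<in> Q \<Longrightarrow> k' \<in> Q' \<Longrightarrow> (k, k') \<in> ?R \<Longrightarrow> \<sigma> \<in> pstr (game E1) {0, 1} Q \<Longrightarrow>
      l' \<in> succs (game E2) {0, 1} k' (const_strat Q') \<Longrightarrow>
      \<exists>l\<in>succs (game E1) {0, 1} k \<sigma>. (l, l') \<in> ?R"
    by meson+
  show ?thesis
    unfolding simulation_def
  proof (intro conjI exI[of _ "\<lambda>Q Q' \<sigma>. const_strat Q'"] *(1), goal_cases)
    case 1
    show ?case using const_strat_pstr by blast
  next
    case 2
    show ?case using *(2-4) by (intro ballI, unfold split_paired_all prod.case) meson
  qed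
qed

lemma simulationD:
  assumes sim: "simulation {0, 1} (game E1) (game E2) R"
    and E: "edges_within E1" "edges_within E2"
    and fg: "word E1 f n" "word E2 g m" "(run f n, run g m) \<in> R"
  shows "lab (f n) = lab (g m)"
    and "i \<in> {0, 1} \<Longrightarrow> word E2 g' m \<Longrightarrow> \<forall>p\<le>m. key i (g p) = key i (g' p) \<Longrightarrow>
      \<exists>f'. word E1 f' n \<and> (\<forall>p\<le>n. key i (f p) = key i (f' p)) \<and> (run f' n, run g' m) \<in> R"
    and "E2 (g m) t \<Longrightarrow>
      \<exists>s. E1 (f n) s \<and> (run (f(Suc n := s)) (Suc n), run (g(Suc m := t)) (Suc m)) \<in> R"
proof -
  from sim obtain ST where
    ST: "\<forall>h\<in>hist (game E1). \<forall>h'\<in>hist (game E2).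
        ST (nbhd (game E1) {0, 1} h) (nbhd (game E2) {0, 1} h')
          \<in> pstr (game E1) {0, 1} (nbhd (game E1) {0, 1} h)
            \<rightarrow> pstr (game E2) {0, 1} (nbhd (game E2) {0, 1} h')"
    and R: "\<forall>(h, h')\<in>R.
        label (game E1) (last_state h) = label (game E2) (last_state h') \<and>
        (\<forall>i\<in>{0, 1}. \<forall>k'. (h', k') \<in> hist_indist (game E2) i \<longrightarrow>
          (\<exists>k. (h, k) \<in> hist_indist (game E1) i \<and> (k, k') \<in> R)) \<and>
        (\<forall>k\<in>nbhd (game E1) {0, 1} h. \<forall>k'\<in>nbhd (game E2) {0, 1} h'. (k, k') \<in> R \<longrightarrow>
          (\<forall>\<sigma>\<in>pstr (game E1) {0, 1} (nbhd (game E1) {0, 1} h).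
            \<forall>l'\<in>succs (game E2) {0, 1} k' (ST (nbhd (game E1) {0, 1} h) (nbhd (game E2) {0, 1} h') \<sigma>).
              \<exists>l\<in>succs (game E1) {0, 1} k \<sigma>. (l, l') \<in> R))"
    unfolding simulation_def by blast
  note Rfg = bspec[OF R fg(3), unfolded prod.case]
  from Rfg show "lab (f n) = lab (g m)" by simp
  show "\<exists>f'. word E1 f' n \<and> (\<forall>p\<le>n. key i (f p) = key i (f' p)) \<and> (run f' n, run g' m) \<in> R"
    if "i \<in> {0, 1}" "word E2 g' m" "\<forall>p\<le>m. key i (g p) = key i (g' p)"
  proof -
    have "(run g m, run g' m) \<in> hist_indist (game E2) i"
      unfolding hist_indist_run[OF E(2) fg(2)] using that by blast
    with Rfg that(1) obtain k where "(run f n, k) \<in> hist_indist (game E1) i" "(k, run g' m) \<in> R"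
      by blast
    then show ?thesis unfolding hist_indist_run[OF E(1) fg(1)] by blast
  qed
  show "\<exists>s. E1 (f n) s \<and> (run (f(Suc n := s)) (Suc n), run (g(Suc m := t)) (Suc m)) \<in> R"
    if t: "E2 (g m) t"
  proof -
    let ?Q = "nbhd (game E1) {0, 1} (run f n)" and ?Q' = "nbhd (game E2) {0, 1} (run g m)"
    let ?\<sigma> = "ST ?Q ?Q' (const_strat ?Q)"
    have "?\<sigma> \<in> pstr (game E2) {0, 1} ?Q'"
      using ST run_in_hist[OF fg(1)] run_in_hist[OF fg(2)] const_strat_pstr by blast
    from succs_run[OF this nbhd_refl fg(2)] t
    have "run (g(Suc m := t)) (Suc m) \<in> succs (game E2) {0, 1} (run g m) ?\<sigma>" by blast
    with Rfg nbhd_refl fg(3) const_strat_pstr obtain l where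
      "l \<in> succs (game E1) {0, 1} (run f n) (const_strat ?Q)" "(l, run (g(Suc m := t)) (Suc m)) \<in> R"
      by blast
    then show ?thesis
      unfolding succs_run[OF const_strat_pstr nbhd_refl fg(1)] by blast
  qed
qed

end

section \<open>Register machines as games\<close>

subsection \<open>Letters\<close>

definition tracks :: "(nat \<Rightarrow> nat) \<Rightarrow> nat \<Rightarrow> nat set" where
  "tracks v p = {j. p < v j}"

fun everywhere :: "instr \<Rightarrow> nat set \<Rightarrow> nat set \<Rightarrow> bool" where
  "everywhere Nop A B \<longleftrightarrow> B = A"
| "everywhere (Copy j k) A B \<longleftrightarrow> (\<forall>i. i \<in> B \<longleftrightarrow> (if i = j then k else i) \<in> A)"
| "everywhere (Inc j) A B \<longleftrightarrow> B - {j} = A - {j}"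
| "everywhere (Dec j) A B \<longleftrightarrow> B - {j} = A - {j}"
| "everywhere (IsZero j) A B \<longleftrightarrow> j \<notin> A \<and> B = A"

fun first :: "instr \<Rightarrow> nat set \<Rightarrow> nat set \<Rightarrow> bool" where
  "first (Inc j) A B \<longleftrightarrow> j \<in> B"
| "first (Dec j) A B \<longleftrightarrow> j \<in> A"
| "first _ A B \<longleftrightarrow> True"

fun consecutive :: "instr \<Rightarrow> nat set \<Rightarrow> nat set \<Rightarrow> nat set \<Rightarrow> nat set \<Rightarrow> bool" where
  "consecutive (Inc j) A B A' B' \<longleftrightarrow> (j \<in> B' \<longleftrightarrow> j \<in> A)"
| "consecutive (Dec j) A B A' B' \<longleftrightarrow> (j \<in> B \<longleftrightarrow> j \<in> A')"
| "consecutive _ A B A' B' \<longleftrightarrow> True"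

lemma empty_letter: "everywhere i {} {}" "consecutive i {} {} {} {}"
  by (cases i; simp)+

lemma nat_eq_tracks: "(\<forall>p. p < x \<longleftrightarrow> p < y) \<longleftrightarrow> x = (y :: nat)"
  by (metis linorder_neqE_nat less_irrefl)

lemma effect_tracks:
  "effect i v w \<longleftrightarrow> (\<forall>p. everywhere i (tracks v p) (tracks w p)) \<and>
    first i (tracks v 0) (tracks w 0) \<and>
    (\<forall>p. consecutive i (tracks v p) (tracks w p) (tracks v (Suc p)) (tracks w (Suc p)))"
proof -
  have others: "(\<forall>p. tracks w p - {j} = tracks v p - {j}) \<longleftrightarrow> (\<forall>k. k \<noteq> j \<longrightarrow> w k = v k)" for j
  proof -
    have "(\<forall>p. tracks w p - {j} = tracks v p - {j}) \<longleftrightarrow> (\<forall>k. k \<noteq> j \<longrightarrow> (\<forall>p. p < w k \<longleftrightarrow> p < v k))"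
      by (auto simp: tracks_def set_eq_iff)
    then show ?thesis unfolding nat_eq_tracks .
  qed
  have same: "(\<forall>p. tracks w p = tracks v p) \<longleftrightarrow> w = v"
  proof -
    have "(\<forall>p. tracks w p = tracks v p) \<longleftrightarrow> (\<forall>k p. p < w k \<longleftrightarrow> p < v k)"
      by (auto simp: tracks_def set_eq_iff)
    then show ?thesis unfolding nat_eq_tracks fun_eq_iff .
  qed
  have upd: "w = v(j := y) \<longleftrightarrow> (\<forall>k. k \<noteq> j \<longrightarrow> w k = v k) \<and> w j = y" for j y
    by (metis fun_upd_apply fun_upd_idem_iff fun_upd_other ext)
  show ?thesis
  proof (cases i)
    case (Copy j k)
    have "w = v(j := v k) \<longleftrightarrow> (\<forall>l. w l = v (if l = j then k else l))"
      by (auto simp: fun_eq_iff)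
    also have "\<dots> \<longleftrightarrow> (\<forall>l p. p < w l \<longleftrightarrow> p < v (if l = j then k else l))"
      unfolding nat_eq_tracks ..
    finally show ?thesis
      unfolding Copy effect.simps everywhere.simps first.simps consecutive.simps tracks_def
        mem_Collect_eq by blast
  next
    case (Inc j)
    have "w j = Suc (v j) \<longleftrightarrow> 0 < w j \<and> (\<forall>p. Suc p < w j \<longleftrightarrow> p < v j)"
      by (cases "w j") (simp_all add: nat_eq_tracks)
    then show ?thesis
      unfolding Inc effect.simps everywhere.simps first.simps consecutive.simps others upd
      unfolding tracks_def mem_Collect_eq by blast
  next
    case (Dec j)
    have "0 < v j \<and> w j = v j - 1 \<longleftrightarrow> 0 < v j \<and> (\<forall>p. p < w j \<longleftrightarrow> Suc p < v j)"
      by (cases "v j") (simp_all add: nat_eq_tracks)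
    then show ?thesis
      unfolding Dec effect.simps everywhere.simps first.simps consecutive.simps others upd
      unfolding tracks_def mem_Collect_eq by blast
  next
    case (IsZero j)
    have "v j = 0 \<longleftrightarrow> (\<forall>p. \<not> p < v j)" by auto
    then show ?thesis
      unfolding IsZero effect.simps everywhere.simps first.simps consecutive.simps same[symmetric]
      unfolding tracks_def mem_Collect_eq by blast
  qed (use same in auto)
qed

definition tracks_code :: "(nat \<Rightarrow> nat) \<Rightarrow> nat \<Rightarrow> nat" where
  "tracks_code v p = set_encode (tracks v p)"

definition supported :: "nat \<Rightarrow> (nat \<Rightarrow> nat) \<Rightarrow> bool" where
  "supported K v \<longleftrightarrow> (\<forall>j\<ge>K. v j = 0)"

lemma supported_tracks: "supported K v \<Longrightarrow> tracks v p \<subseteq> {..<K}"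
  by (auto simp: supported_def tracks_def) (metis not_less not_less_zero)

lemma decode_tracks: "supported K v \<Longrightarrow> set_decode (tracks_code v p) = tracks v p"
  unfolding tracks_code_def by (meson finite_lessThan finite_subset set_encode_inverse supported_tracks)

lemma tracks_code_eq_0: "(\<And>j. v j \<le> p) \<Longrightarrow> tracks_code v p = 0"
  unfolding tracks_code_def tracks_def by (subst Collect_empty_eq[THEN iffD2]) (auto simp: not_less)

lemma tracks_code_inject:
  assumes "supported K v" "supported K w" "\<And>j. v j \<le> n" "\<And>j. w j \<le> n"
    and eq: "\<And>p. p < n \<Longrightarrow> tracks_code v p = tracks_code w p"
  shows "v = w"
proof
  fix j
  have "p < v j \<longleftrightarrow> p < w j" for p
  proof (cases "p < n")
    case True
    then have "tracks v p = tracks w p" using eq decode_tracks assms(1,2) by metis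
    then show ?thesis by (auto simp: tracks_def)
  next
    case False
    then show ?thesis using assms(3,4)[of j] by linarith
  qed
  then show "v j = w j" using nat_eq_tracks by metis
qed

lemma tracks_recover:
  assumes "0 < n" "A n = 0" "\<And>p. 0 < p \<Longrightarrow> p < n \<Longrightarrow> set_decode (A (Suc p)) \<subseteq> set_decode (A p)"
    and K: "set_decode (A (Suc 0)) \<subseteq> {..<K}"
  shows "\<exists>v. supported K v \<and> (\<forall>j. v j < n) \<and> (\<forall>p. 0 < p \<longrightarrow> p \<le> n \<longrightarrow> A p = tracks_code v (p - 1))"
proof -
  define v where "v j = (LEAST p. j \<notin> set_decode (A (Suc p)))" for j
  have A: "j \<notin> set_decode (A (Suc (n - 1)))" for j using assms(1,2) by simp
  have lt: "v j < n" for j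
    using Least_le[of "\<lambda>p. j \<notin> set_decode (A (Suc p))", OF A] assms(1) unfolding v_def by linarith
  have v: "j \<notin> set_decode (A (Suc (v j)))" for j
    unfolding v_def by (rule LeastI[of "\<lambda>p. j \<notin> set_decode (A (Suc p))", OF A])
  have anti: "set_decode (A (Suc p)) \<subseteq> set_decode (A (Suc q))" if "q \<le> p" "p < n" for p q
    using that assms(3) by (induction p) (auto simp: le_Suc_eq)
  have sup: "supported K v"
    unfolding supported_def v_def using K by (auto intro!: Least_equality)
  have "A (Suc p) = tracks_code v p" if "p < n" for p
  proof -
    have "set_decode (A (Suc p)) = tracks v p"
      using anti[OF _ that] v not_less_Least[of p, folded v_def]
      by (auto simp: tracks_def v_def not_less intro: ccontr)
        (metis linorder_not_less subset_iff v v_def)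
    then show ?thesis by (metis set_decode_inverse tracks_code_def)
  qed
  then have "\<forall>p. 0 < p \<longrightarrow> p \<le> n \<longrightarrow> A p = tracks_code v (p - 1)"
    by (metis Suc_diff_1 Suc_le_lessD)
  with sup lt show ?thesis by blast
qed

text \<open>
  In a letter \<open>Trans q i q' a b\<close> at position \<open>Suc p\<close> of a word (position \<open>0\<close> holds \<open>Begin\<close>), \<open>a\<close> and
  \<open>b\<close> code the sets of registers whose values before and after the step exceed \<open>p\<close>.
\<close>

datatype 'q letter =
    Begin
  | Chain nat
  | Trans 'q instr 'q nat nat
  | End
  | End2
  | Halt
  | Sink

instance instr :: countable by countable_datatype
instance letter :: (countable) countable by countable_datatype

fun lab :: "'q letter \<Rightarrow> nat set" where
  "lab (Chain j) = {0}"
| "lab End = {1}"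
| "lab End2 = {1}"
| "lab Halt = {2}"
| "lab _ = {}"

definition input :: "nat \<Rightarrow> nat \<Rightarrow> nat" where
  "input x = (\<lambda>_. 0)(0 := x)"

locale machine =
  fixes \<Delta> :: "('q::countable \<times> instr \<times> 'q) set" and q0 acc :: 'q and K :: nat
  assumes finite_\<Delta>: "finite \<Delta>"
    and registers: "(q, i, q') \<in> \<Delta> \<Longrightarrow> registers i \<subseteq> {..<K}"
    and K: "0 < K"
    and no_in: "(q, i, q0) \<notin> \<Delta>"
    and no_out: "(acc, i, q) \<notin> \<Delta>"
    and q0_acc: "q0 \<noteq> acc"
    and deterministic: "(q, i, q') \<in> \<Delta> \<Longrightarrow> (q, k, q'') \<in> \<Delta> \<Longrightarrow> effect i v w \<Longrightarrow> effect k v w' \<Longrightarrow>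
      q' = q'' \<and> w = w'"
begin

definition step :: "'q \<times> (nat \<Rightarrow> nat) \<Rightarrow> 'q \<times> (nat \<Rightarrow> nat) \<Rightarrow> bool" where
  "step = (\<lambda>(q, v) (q', w). \<exists>i. (q, i, q') \<in> \<Delta> \<and> effect i v w)"

definition control :: "'q set" where
  "control = {q0, acc} \<union> fst ` \<Delta> \<union> (\<lambda>(q, i, q'). q') ` \<Delta>"

text \<open>The idle edges make the words of the form \<open>c c\<close> available besides those of the form \<open>c c'\<close>.\<close>

definition edges :: "('q \<times> instr \<times> 'q) set" where
  "edges = \<Delta> \<union> (\<lambda>q. (q, Nop, q)) ` control"

definition mark :: "'q letter" where
  "mark = Trans q0 Nop q0 1 1"

definition enc :: "'q letter \<Rightarrow> nat" where
  "enc s = (case s of Chain j \<Rightarrow> 2 * j | Begin \<Rightarrow> 1 | _ \<Rightarrow> if s = mark then 3 else 2 * to_nat s + 5)"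

lemma enc_simps: "enc (Chain j) = 2 * j" "enc Begin = 1" "enc mark = 3"
  by (auto simp: enc_def mark_def)

lemma enc_odd: "(\<forall>j. s \<noteq> Chain j) \<Longrightarrow> odd (enc s)"
  by (auto simp: enc_def split: letter.split)

lemma inj_enc: "inj enc"
proof (rule injI)
  fix s t assume eq: "enc s = enc t"
  show "s = t"
  proof (cases "(\<exists>j. s = Chain j) \<or> (\<exists>j. t = Chain j)")
    case True
    have "even (enc (Chain j))" for j by (simp add: enc_simps)
    with True eq enc_odd[of s] enc_odd[of t] obtain j k where "s = Chain j" "t = Chain k"
      by metis
    with eq show ?thesis by (simp add: enc_simps)
  next
    case False
    have "enc u = (if u = Begin then 1 else if u = mark then 3 else 2 * to_nat u + 5)"
      if "\<nexists>j. u = Chain j" for u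
      using that by (auto simp: enc_def mark_def split: letter.split)
    then have e: "enc s = (if s = Begin then 1 else if s = mark then 3 else 2 * to_nat s + 5)"
      "enc t = (if t = Begin then 1 else if t = mark then 3 else 2 * to_nat t + 5)"
      using False by blast+
    have "(if s = Begin then 1 else if s = mark then 3 else 2 * to_nat s + 5) =
        (if t = Begin then 1 else if t = mark then 3 else 2 * to_nat t + 5)"
      using eq unfolding e .
    then have "s = Begin \<and> t = Begin \<or> s = mark \<and> t = mark \<or> to_nat s = to_nat t"
      by (simp split: if_splits; linarith)
    then show ?thesis by auto
  qed
qed

fun key :: "nat \<Rightarrow> 'q letter \<Rightarrow> 'q letter" where
  "key 0 (Trans q i q' a b) = Trans q Nop q a a"
| "key (Suc k) (Trans q i q' a b) = Trans q' Nop q' b b"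
| "key (Suc k) (Chain (Suc j)) = Trans q0 Nop q0 1 1"
| "key (Suc k) (Chain 0) = Trans q0 Nop q0 0 0"
| "key k Halt = End"
| "key k s = s"

definition trans_letters :: "'q letter set" where
  "trans_letters = {Trans q i q' a b | q i q' a b. (q, i, q') \<in> edges \<and>
    set_decode a \<subseteq> {..<K} \<and> set_decode b \<subseteq> {..<K} \<and> everywhere i (set_decode a) (set_decode b)}"

definition base :: "'q letter set" where
  "base = {Begin, Chain 0, End, End2, Halt, Sink} \<union> trans_letters"

fun base_edge :: "'q letter \<Rightarrow> 'q letter \<Rightarrow> 'q letter \<Rightarrow> bool" where
  "base_edge e Begin t \<longleftrightarrow> t \<in> trans_letters \<and>
    (\<exists>q i q' a b. t = Trans q i q' a b \<and> first i (set_decode a) (set_decode b))"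
| "base_edge e (Chain j) t \<longleftrightarrow> j = 0 \<and> (t = Chain 0 \<or> t = e)"
| "base_edge e (Trans q i q' a b) t \<longleftrightarrow> Trans q i q' a b \<in> trans_letters \<and>
    (t = Sink \<or>
     a = 0 \<and> b = 0 \<and> t = (if q = acc then Halt else End) \<or>
     t \<in> trans_letters \<and> (\<exists>a' b'. t = Trans q i q' a' b' \<and>
       set_decode a' \<subseteq> set_decode a \<and> set_decode b' \<subseteq> set_decode b \<and>
       consecutive i (set_decode a) (set_decode b) (set_decode a') (set_decode b')))"
| "base_edge e s t \<longleftrightarrow> t = s"

lemma stepI: "(q, i, q') \<in> \<Delta> \<Longrightarrow> effect i v w \<Longrightarrow> step (q, v) (q', w)"
  by (auto simp: step_def)

lemma edges_acc: "(acc, i, q) \<in> edges \<Longrightarrow> i = Nop \<and> q = acc"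
  using no_out by (auto simp: edges_def)

lemma edges_q0: "(q, i, q0) \<in> edges \<Longrightarrow> i = Nop \<and> q = q0"
  using no_in by (auto simp: edges_def)

lemma control_idle: "q \<in> control \<Longrightarrow> (q, Nop, q) \<in> edges"
  by (simp add: edges_def)

lemma edges_step: "(q, i, q') \<in> edges \<Longrightarrow> effect i v w \<Longrightarrow> step\<^sup>=\<^sup>= (q, v) (q', w)"
  by (auto simp: edges_def step_def)

lemma step_deterministic: "step c c' \<Longrightarrow> step c c'' \<Longrightarrow> c' = c''"
  using deterministic by (fastforce simp: step_def)

lemma steps_forward:
  assumes "step\<^sup>*\<^sup>* c t" "step\<^sup>=\<^sup>= c c'" "\<nexists>u. step t u"
  shows "step\<^sup>*\<^sup>* c' t"
proof (cases "c = c'")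
  case False
  with assms(2) have "step c c'" by auto
  from assms(1) show ?thesis
  proof (cases rule: converse_rtranclpE)
    case base
    with \<open>step c c'\<close> assms(3) show ?thesis by blast
  next
    case (step u)
    with \<open>step c c'\<close> show ?thesis using step_deterministic by blast
  qed
qed (use assms(1) in simp)

lemma effect_supported:
  "(q, i, q') \<in> \<Delta> \<Longrightarrow> effect i v w \<Longrightarrow> supported K v \<Longrightarrow> supported K w"
  using registers[of q i q'] by (cases i) (auto simp: supported_def)

lemma supported_input: "supported K (input x)"
  using K by (simp add: supported_def input_def)

lemma finite_base: "finite base"
proof -
  have fin: "finite {a. set_decode a \<subseteq> {..<K}}"
  proof (rule finite_imageD)
    show "finite (set_decode ` {a. set_decode a \<subseteq> {..<K}})"
      by (rule finite_subset[of _ "Pow {..<K}"]) auto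
    show "inj_on set_decode {a. set_decode a \<subseteq> {..<K}}"
      by (metis inj_onI set_decode_inverse)
  qed
  have "finite edges"
    using finite_\<Delta> by (simp add: edges_def control_def)
  moreover have "trans_letters \<subseteq> (\<lambda>((q, i, q'), a, b). Trans q i q' a b) `
      (edges \<times> {a. set_decode a \<subseteq> {..<K}} \<times> {a. set_decode a \<subseteq> {..<K}})"
    by (force simp: trans_letters_def)
  ultimately have "finite trans_letters"
    using fin by (meson finite_SigmaI finite_imageI finite_subset)
  then show ?thesis by (simp add: base_def)
qed

end

locale machine_input = machine \<Delta> q0 acc K
  for \<Delta> :: "('q::countable \<times> instr \<times> 'q) set" and q0 acc K +
  fixes x :: nat
begin

definition letters :: "'q letter set" where
  "letters = base \<union> Chain ` {..x}"

definition edge :: "'q letter \<Rightarrow> 'q letter \<Rightarrow> 'q letter \<Rightarrow> bool" where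
  "edge e s t \<longleftrightarrow> base_edge e s t \<or> s = Begin \<and> t = Chain x \<or> (\<exists>j<x. s = Chain (Suc j) \<and> t = Chain j)"

sublocale word_game enc letters Begin key lab
  by unfold_locales (auto simp: inj_enc letters_def base_def)

lemma edge_simps:
  "edge e Begin t \<longleftrightarrow> t = Chain x \<or> t \<in> trans_letters \<and>
    (\<exists>q i q' a b. t = Trans q i q' a b \<and> first i (set_decode a) (set_decode b))"
  "edge e (Chain 0) t \<longleftrightarrow> t = Chain 0 \<or> t = e"
  "edge e (Chain (Suc j)) t \<longleftrightarrow> j < x \<and> t = Chain j"
  "edge e (Trans q i q' a b) t \<longleftrightarrow> Trans q i q' a b \<in> trans_letters \<and>
    (t = Sink \<or>
     a = 0 \<and> b = 0 \<and> t = (if q = acc then Halt else End) \<or>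
     t \<in> trans_letters \<and> (\<exists>a' b'. t = Trans q i q' a' b' \<and>
       set_decode a' \<subseteq> set_decode a \<and> set_decode b' \<subseteq> set_decode b \<and>
       consecutive i (set_decode a) (set_decode b) (set_decode a') (set_decode b')))"
  "edge e End t \<longleftrightarrow> t = End"
  "edge e End2 t \<longleftrightarrow> t = End2"
  "edge e Halt t \<longleftrightarrow> t = Halt"
  "edge e Sink t \<longleftrightarrow> t = Sink"
  by (auto simp: edge_def)

lemma edges_within: "e \<in> {End, End2} \<Longrightarrow> edges_within (edge e)"
proof (unfold edges_within_def, intro allI impI)
  fix s t assume "e \<in> {End, End2}" "edge e s t"
  then show "s \<in> letters \<and> t \<in> letters"
    unfolding edge_def
    by (cases s) (auto simp: letters_def base_def split: if_splits)
qed

lemma finite_letters: "finite letters"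
  using finite_base by (simp add: letters_def)

lemma edge_total:
  assumes "s \<in> letters"
  shows "\<exists>t. edge e s t"
proof (cases s)
  case (Chain j)
  with assms show ?thesis
    by (cases j) (auto simp: edge_simps letters_def base_def trans_letters_def)
next
  case (Trans q i q' a b)
  with assms show ?thesis by (auto simp: edge_simps letters_def base_def)
qed (auto simp: edge_simps)

lemma finite_icgs_edge: "e \<in> {End, End2} \<Longrightarrow> finite_icgs (game (edge e))"
  by (intro finite_icgs_game finite_letters edges_within edge_total)

end

context machine_input
begin

definition chain_word :: "nat \<Rightarrow> 'q letter \<Rightarrow> nat \<Rightarrow> 'q letter" where
  "chain_word n e p = (if p = 0 then Begin else if p \<le> n then Chain (Suc x - p) else e)"

definition step_word ::
  "'q \<Rightarrow> instr \<Rightarrow> 'q \<Rightarrow> (nat \<Rightarrow> nat) \<Rightarrow> (nat \<Rightarrow> nat) \<Rightarrow> nat \<Rightarrow> nat \<Rightarrow> 'q letter" where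
  "step_word q i q' v w n p = (if p = 0 then Begin
    else if p \<le> n then Trans q i q' (tracks_code v (p - 1)) (tracks_code w (p - 1))
    else if q = acc then Halt else End)"

lemma chain_word_word:
  assumes "x < n" "e \<in> {End, End2}"
  shows "word (edge e) (chain_word n e) N"
proof -
  have "edge e (chain_word n e p) (chain_word n e (Suc p))" for p
  proof (cases "p = 0 \<or> n < p")
    case True
    then show ?thesis using assms by (auto simp: chain_word_def edge_simps)
  next
    case False
    then have "Suc x - p = (if p \<le> x then Suc (x - p) else 0)" by auto
    with False assms show ?thesis by (auto simp: chain_word_def edge_simps)
  qed
  then show ?thesis by (simp add: word_def chain_word_def)
qed

lemma step_word_word:
  assumes "(q, i, q') \<in> edges" "effect i v w" "supported K v" "supported K w"
    and n: "\<And>j. v j < n" "\<And>j. w j < n"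
  shows "word (edge e) (step_word q i q' v w n) N"
proof -
  have 0: "0 < n" using n(1)[of 0] by simp
  have T: "Trans q i q' (tracks_code v p) (tracks_code w p) \<in> trans_letters" for p
    using assms(1-4) supported_tracks
    by (auto simp: trans_letters_def decode_tracks effect_tracks)
  have mono: "tracks v (Suc p) \<subseteq> tracks v p" for v p by (auto simp: tracks_def)
  have "edge e (step_word q i q' v w n p) (step_word q i q' v w n (Suc p))" for p
  proof (cases "p = 0")
    case True
    then show ?thesis
      using T[of 0] 0 assms(2-4) by (simp add: step_word_def edge_simps decode_tracks effect_tracks)
  next
    case False
    then obtain k where k: "p = Suc k" by (cases p) auto
    consider "p < n" | "p = n" | "n < p" by linarith
    then show ?thesis
    proof cases
      case 1
      then show ?thesis
        using T[of k] T[of "Suc k"] assms(2-4) mono k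
        by (simp add: step_word_def edge_simps decode_tracks effect_tracks)
    next
      case 2
      have "v j \<le> k" "w j \<le> k" for j using n[of j] 2 k by auto
      then have "tracks_code v k = 0" "tracks_code w k = 0" by (simp_all add: tracks_code_eq_0)
      moreover have "n - Suc 0 = k" using 2 k by simp
      ultimately show ?thesis using T[of k] 2 k by (simp add: step_word_def edge_simps)
    next
      case 3
      then show ?thesis using False by (simp add: step_word_def edge_simps)
    qed
  qed
  then show ?thesis by (simp add: word_def step_word_def)
qed

lemma word_chain:
  assumes "word (edge e) f n" "e \<in> {End, End2}" "f n = Chain k" "p \<le> n"
  shows "f p = chain_word n e p"
  using assms(1,3,4)
proof (induction n arbitrary: k p)
  case 0
  then show ?case by (simp add: chain_word_def word_def)
next
  case (Suc n)
  have e: "edge e (f n) (Chain k)" and w: "word (edge e) f n"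
    using Suc.prems by (auto simp: word_Suc)
  show ?case
  proof (cases "n = 0")
    case True
    with e w Suc.prems(2,3) show ?thesis
      by (cases p) (auto simp: chain_word_def word_def edge_simps trans_letters_def)
  next
    case False
    have "f n \<noteq> Begin"
    proof -
      obtain n' where "n = Suc n'" using False by (cases n) auto
      with w assms(2) have "edge e (f n') (f n)" by (simp add: word_Suc)
      then show ?thesis using assms(2)
        by (cases "f n'") (auto simp: edge_def trans_letters_def split: if_splits)
    qed
    with e assms(2) obtain k' where k': "f n = Chain k'" "k' = Suc k \<or> k' = 0 \<and> k = 0"
      by (cases "f n") (auto simp: edge_def trans_letters_def split: if_splits)
    have IH: "f p = chain_word n e p" if "p \<le> n" for p
      using Suc.IH[OF w k'(1) that] .
    from IH[of n] k'(1) False have "k' = Suc x - n" by (simp add: chain_word_def)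
    with k'(2) Suc.prems(2) have "f (Suc n) = chain_word (Suc n) e (Suc n)"
      by (auto simp: chain_word_def)
    moreover have "chain_word (Suc n) e p = chain_word n e p" if "p \<le> n"
      using that by (simp add: chain_word_def)
    ultimately show ?thesis using IH Suc.prems(3) by (cases "p = Suc n") auto
  qed
qed

lemma constant_tail:
  assumes "word (edge e) f N" "f n \<in> {End, End2, Halt}" "n \<le> p" "p \<le> N"
  shows "f p = f n"
  using assms(3,4)
proof (induction p rule: nat_induct_at_least)
  case (Suc p)
  then have "p < N" "f p = f n" by simp_all
  moreover from \<open>p < N\<close> have "edge e (f p) (f (Suc p))" using assms(1) unfolding word_def by blast
  ultimately have "edge e (f n) (f (Suc p))" by simp
  with assms(2) show ?case by (auto simp: edge_simps)
qed simp

lemma word_shape: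
  assumes w: "word (edge End) f N" and n: "0 < n" "n < N"
    and body: "\<And>p. 0 < p \<Longrightarrow> p \<le> n \<Longrightarrow> f p \<notin> {End, End2, Halt}" and tail: "f (Suc n) \<in> {End, Halt}"
  obtains "x < n" "\<And>p. p \<le> N \<Longrightarrow> f p = chain_word n End p"
  | q i q' v w where "(q, i, q') \<in> edges" "effect i v w" "supported K v" "supported K w"
      "\<And>j. v j < n" "\<And>j. w j < n" "\<And>p. p \<le> N \<Longrightarrow> f p = step_word q i q' v w n p"
proof -
  have edge: "edge End (f p) (f (Suc p))" if "p < N" for p using w that by (simp add: word_def)
  have f0: "f 0 = Begin" using w by (simp add: word_def)
  have last: "edge End (f n) (f (Suc n))" using edge n by blast
  have tail': "f p = f (Suc n)" if "n < p" "p \<le> N" for p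
    using constant_tail[OF w, of "Suc n" p] tail that by auto
  have first: "edge End Begin (f 1)" using edge[of 0] f0 n by simp
  then consider "f 1 = Chain x" | q i q' a b where "f 1 = Trans q i q' a b" "f 1 \<in> trans_letters"
      "first i (set_decode a) (set_decode b)"
    by (auto simp: edge_simps)
  then show thesis
  proof cases
    case 1
    have "\<exists>k. f p = Chain k" if "0 < p" "p \<le> n" for p
      using that
    proof (induction p rule: nat_induct_non_zero)
      case (Suc p)
      then obtain k where "f p = Chain k" by auto
      moreover have "edge End (f p) (f (Suc p))" using edge Suc n by simp
      ultimately show ?case using body[of "Suc p"] Suc.prems
        by (cases k) (auto simp: edge_simps)
    qed (use 1 in auto)
    then obtain k where k: "f n = Chain k" using n by auto
    have "word (edge End) f n" using w n by (simp add: word_def)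
    from word_chain[OF this _ k] have chain: "f p = chain_word n End p" if "p \<le> n" for p
      using that by simp
    from last k tail have "k = 0" "f (Suc n) = End" by (cases k; auto simp: edge_simps)+
    with chain[of n] k n have "x < n" by (auto simp: chain_word_def)
    moreover have "f p = chain_word n End p" if "p \<le> N" for p
      using chain[of p] tail'[of p] that \<open>f (Suc n) = End\<close> by (cases "p \<le> n") (auto simp: chain_word_def)
    ultimately show thesis by (rule that(1))
  next
    case (2 q i q' a b)
    have "\<exists>a b. f p = Trans q i q' a b \<and> f p \<in> trans_letters" if "0 < p" "p \<le> n" for p
      using that
    proof (induction p rule: nat_induct_non_zero)
      case (Suc p)
      then obtain a b where "f p = Trans q i q' a b" by auto
      moreover have "edge End (f p) (f (Suc p))" using edge Suc n by simp
      moreover have "f (Suc p) \<noteq> Sink"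
      proof
        assume "f (Suc p) = Sink"
        have "f r = Sink" if "Suc p \<le> r" "r \<le> N" for r
          using that
        proof (induction r rule: nat_induct_at_least)
          case (Suc r)
          then show ?case using edge[of r] by (simp add: edge_simps)
        qed (rule \<open>f (Suc p) = Sink\<close>)
        then show False using tail Suc.prems n by auto
      qed
      ultimately show ?case using body[of "Suc p"] Suc.prems
        by (auto simp: edge_simps split: if_splits)
    qed (use 2 in auto)
    then obtain A B where AB: "\<And>p. 0 < p \<Longrightarrow> p \<le> n \<Longrightarrow>
        f p = Trans q i q' (A p) (B p) \<and> Trans q i q' (A p) (B p) \<in> trans_letters"
      by metis
    have next_letter: "set_decode (A (Suc p)) \<subseteq> set_decode (A p) \<and> set_decode (B (Suc p)) \<subseteq> set_decode (B p) \<and>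
        consecutive i (set_decode (A p)) (set_decode (B p)) (set_decode (A (Suc p))) (set_decode (B (Suc p)))"
      if "0 < p" "p < n" for p
      using edge[of p] AB[of p] AB[of "Suc p"] that n by (auto simp: edge_simps split: if_splits)
    have zero: "A n = 0" "B n = 0" and tail_q: "f (Suc n) = (if q = acc then Halt else End)"
      using last AB[of n] n tail by (auto simp: edge_simps split: if_splits)
    have T: "(q, i, q') \<in> edges" "set_decode (A 1) \<subseteq> {..<K}" "set_decode (B 1) \<subseteq> {..<K}"
      using AB[of 1] n by (auto simp: trans_letters_def)
    from tracks_recover[where A = A and n = n and K = K, OF n(1) zero(1)] next_letter T obtain v where
      v: "supported K v" "\<And>j. v j < n" "\<And>p. 0 < p \<Longrightarrow> p \<le> n \<Longrightarrow> A p = tracks_code v (p - 1)"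
      by (metis One_nat_def)
    from tracks_recover[where A = B and n = n and K = K, OF n(1) zero(2)] next_letter T obtain w where
      w: "supported K w" "\<And>j. w j < n" "\<And>p. 0 < p \<Longrightarrow> p \<le> n \<Longrightarrow> B p = tracks_code w (p - 1)"
      by (metis One_nat_def)
    have letter: "set_decode (A (Suc p)) = tracks v p" "set_decode (B (Suc p)) = tracks w p" if "p < n" for p
      using v(3)[of "Suc p"] w(3)[of "Suc p"] that v(1) w(1) by (simp_all add: decode_tracks)
    have empty: "tracks v p = {}" "tracks w p = {}" if "n \<le> Suc p" for p
      using v(2) w(2) that unfolding tracks_def by (auto simp: not_less) (meson le_trans less_Suc_eq_le not_less)+
    have "everywhere i (tracks v p) (tracks w p)" for p
    proof (cases "p < n")
      case True
      then show ?thesis using AB[of "Suc p"] letter[of p] by (auto simp: trans_letters_def)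
    next
      case False
      then show ?thesis by (simp add: empty empty_letter)
    qed
    moreover have "first i (tracks v 0) (tracks w 0)"
      using 2 AB[of 1] letter[of 0] n by auto
    moreover have "consecutive i (tracks v p) (tracks w p) (tracks v (Suc p)) (tracks w (Suc p))" for p
    proof (cases "Suc p < n")
      case True
      then show ?thesis using next_letter[of "Suc p"] by (simp add: letter)
    next
      case False
      then show ?thesis by (simp add: empty empty_letter)
    qed
    ultimately have eff: "effect i v w" by (simp add: effect_tracks)
    have "f p = step_word q i q' v w n p" if "p \<le> N" for p
      using AB[of p] v(3)[of p] w(3)[of p] tail'[of p] tail_q f0 that
      by (cases "p = 0"; cases "p \<le> n") (auto simp: step_word_def)
    with T(1) eff v(1,2) w(1,2) show thesis by (intro that(2)) auto
  qed
qed

subsection \<open>Bisimilarity of the games of a rejected input\<close>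

definition harmless :: "'q \<times> (nat \<Rightarrow> nat) \<Rightarrow> (nat \<Rightarrow> 'q letter) \<Rightarrow> nat \<Rightarrow> bool" where
  "harmless c f N \<longleftrightarrow> word (edge End) f N \<and> f N = End \<and> (\<exists>n. 0 < n \<and> n < N \<and>
    (x < n \<and> (\<forall>p\<le>N. f p = chain_word n End p) \<or>
     (\<exists>q i q' v w. (q, i, q') \<in> edges \<and> effect i v w \<and> supported K v \<and> supported K w \<and>
        (\<forall>j. v j < n) \<and> (\<forall>j. w j < n) \<and> step\<^sup>*\<^sup>* (q', w) c \<and>
        (\<forall>p\<le>N. f p = step_word q i q' v w n p))))"

lemma key_eq:
  "key i s = End \<longleftrightarrow> s = End \<or> s = Halt"
  "key i s = End2 \<longleftrightarrow> s = End2"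
  "key 0 s = Chain j \<longleftrightarrow> s = Chain j"
  "End = key i s \<longleftrightarrow> s = End \<or> s = Halt"
  "End2 = key i s \<longleftrightarrow> s = End2"
  "Chain j = key 0 s \<longleftrightarrow> s = Chain j"
  by (cases "(i, s)" rule: key.cases; auto; fail | cases "(0 :: nat, s)" rule: key.cases; auto; fail)+

lemma harmless_loop:
  assumes "harmless c f N"
  shows "harmless c (f(Suc N := End)) (Suc N)"
proof -
  have "word (edge End) (f(Suc N := End)) (Suc N)"
    using assms by (simp add: harmless_def word_snoc edge_simps)
  moreover from assms obtain n where n: "0 < n" "n < N" and
    "x < n \<and> (\<forall>p\<le>N. f p = chain_word n End p) \<or>
     (\<exists>q i q' v w. (q, i, q') \<in> edges \<and> effect i v w \<and> supported K v \<and> supported K w \<and>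
        (\<forall>j. v j < n) \<and> (\<forall>j. w j < n) \<and> step\<^sup>*\<^sup>* (q', w) c \<and>
        (\<forall>p\<le>N. f p = step_word q i q' v w n p))" and fN: "f N = End"
    unfolding harmless_def by blast
  then have "x < n \<and> (\<forall>p\<le>Suc N. (f(Suc N := End)) p = chain_word n End p) \<or>
     (\<exists>q i q' v w. (q, i, q') \<in> edges \<and> effect i v w \<and> supported K v \<and> supported K w \<and>
        (\<forall>j. v j < n) \<and> (\<forall>j. w j < n) \<and> step\<^sup>*\<^sup>* (q', w) c \<and>
        (\<forall>p\<le>Suc N. (f(Suc N := End)) p = step_word q i q' v w n p))"
  proof (elim disjE exE conjE, goal_cases)
    case 1
    with n show ?case by (auto simp: chain_word_def le_Suc_eq)
  next
    case (2 q i q' v w)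
    then have "step_word q i q' v w n N = End" by simp
    with n have "step_word q i q' v w n (Suc N) = End" by (simp add: step_word_def)
    with 2 have "\<forall>p\<le>Suc N. (f(Suc N := End)) p = step_word q i q' v w n p"
      by (auto simp: le_Suc_eq)
    with 2 show ?case by blast
  qed
  ultimately show ?thesis
    using n unfolding harmless_def by (intro conjI exI[of _ n]) simp_all
qed

lemma harmless_neighbour:
  assumes f: "harmless c f N" and g: "word (edge End) g N"
    and i: "i \<in> {0, 1}" and key: "\<forall>p\<le>N. key i (f p) = key i (g p)"
    and c: "step\<^sup>*\<^sup>* (q0, input x) c" "fst c \<noteq> acc" "\<nexists>d. step c d"
  shows "harmless c g N"
proof -
  from f obtain n where n: "0 < n" "n < N" and shape: "x < n \<and> (\<forall>p\<le>N. f p = chain_word n End p) \<or>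
     (\<exists>q i q' v w. (q, i, q') \<in> edges \<and> effect i v w \<and> supported K v \<and> supported K w \<and>
        (\<forall>j. v j < n) \<and> (\<forall>j. w j < n) \<and> step\<^sup>*\<^sup>* (q', w) c \<and>
        (\<forall>p\<le>N. f p = step_word q i q' v w n p))" and fN: "f N = End"
    unfolding harmless_def by blast
  have fp: "(\<exists>j. f p = Chain j) \<or> (\<exists>q i q' a b. f p = Trans q i q' a b)" if "0 < p" "p \<le> n" for p
    using shape that n by (fastforce simp: chain_word_def step_word_def)
  have body: "g p \<notin> {End, End2, Halt}" if p: "0 < p" "p \<le> n" for p
  proof
    assume "g p \<in> {End, End2, Halt}"
    then have "key i (g p) \<in> {End, End2}" by (auto simp: key_eq)
    moreover have "key i (f p) = key i (g p)" using key p n by simp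
    ultimately have "f p \<in> {End, Halt, End2}" by (auto simp: key_eq)
    with fp[OF p] show False by auto
  qed
  have "f (Suc n) \<in> {End, Halt}"
    using shape n by (auto simp: chain_word_def step_word_def)
  then have tail: "g (Suc n) \<in> {End, Halt}"
    using key n by (metis Suc_leI insert_iff key_eq(1) singletonD)
  have chain: "harmless c g N" if "x < n" "\<And>p. p \<le> N \<Longrightarrow> g p = chain_word n End p"
    using that g n unfolding harmless_def
    by (intro conjI exI[of _ n]) (auto simp: chain_word_def)
  have not_acc: "q \<noteq> acc" if "(q, i, q') \<in> edges" "step\<^sup>*\<^sup>* (q', w) c" for q i q' w
  proof
    assume "q = acc"
    with that(1) have "q' = acc" using edges_acc by blast
    with that(2) c(2) no_out show False
      by (cases rule: converse_rtranclpE) (auto simp: step_def)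
  qed
  show ?thesis
  proof (rule word_shape[OF g n], goal_cases)
    case (1 p)
    then show ?case by (rule body)
  next
    case 2
    show ?case by (rule tail)
  next
    case 3
    then show ?case by (rule chain)
  next
    case (4 q k q' v w)
    have "step\<^sup>*\<^sup>* (q', w) c"
      using shape
    proof (elim disjE exE conjE)
      assume f: "x < n" "\<forall>p\<le>N. f p = chain_word n End p"
      have keys: "key i (Chain (x - p)) = key i (Trans q k q' (tracks_code v p) (tracks_code w p))"
        if "p < n" for p
        using key[rule_format, of "Suc p"] f(2)[rule_format, of "Suc p"] 4(7)[of "Suc p"] that n
        by (simp add: chain_word_def step_word_def)
      have i1: "i = 1" using keys[of 0] i n by auto
      have "tracks_code w p = tracks_code (input x) p \<and> q' = q0" if "p < n" for p
      proof (cases "p < x")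
        case True
        then have "tracks (input x) p = {0}" by (auto simp: tracks_def input_def)
        then have "tracks_code (input x) p = 1" by (simp add: tracks_code_def)
        moreover from True obtain d where "x - p = Suc d" by (metis Suc_diff_Suc)
        ultimately show ?thesis using keys[OF that] i1 by simp
      next
        case False
        then have "tracks (input x) p = {}" by (auto simp: tracks_def input_def)
        then have "tracks_code (input x) p = 0" by (simp add: tracks_code_def)
        with False keys[OF that] i1 show ?thesis by simp
      qed
      then have "w = input x" "q' = q0"
        using n f(1) 4(6) supported_input
        by (auto intro!: tracks_code_inject[OF 4(4), of _ n] simp: input_def less_imp_le)
      with c(1) show ?thesis by simp
    next
      fix q1 i1 q1' v1 w1
      assume f: "(q1, i1, q1') \<in> edges" "effect i1 v1 w1" "supported K v1" "supported K w1"
        "\<forall>j. v1 j < n" "\<forall>j. w1 j < n" "step\<^sup>*\<^sup>* (q1', w1) c"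
        "\<forall>p\<le>N. f p = step_word q1 i1 q1' v1 w1 n p"
      have keys: "key i (Trans q1 i1 q1' (tracks_code v1 p) (tracks_code w1 p)) =
          key i (Trans q k q' (tracks_code v p) (tracks_code w p))" if "p < n" for p
        using key[rule_format, of "Suc p"] f(8)[rule_format, of "Suc p"] 4(7)[of "Suc p"] that n
        by (simp add: step_word_def)
      show ?thesis
      proof (cases "i = 0")
        case True
        then have "tracks_code v1 p = tracks_code v p \<and> q1 = q" if "p < n" for p
          using keys[OF that] by simp
        then have "v1 = v" "q1 = q"
          using n f(3,5) 4(3,5) by (auto intro!: tracks_code_inject[of K _ _ n] simp: less_imp_le)
        have "step\<^sup>*\<^sup>* (q1, v1) c"
          using edges_step[OF f(1,2)] f(7) by (auto intro: converse_rtranclp_into_rtranclp)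
        then show ?thesis
          using steps_forward[OF _ edges_step[OF 4(1,2)] c(3)] \<open>v1 = v\<close> \<open>q1 = q\<close> by simp
      next
        case False
        with i have "tracks_code w1 p = tracks_code w p \<and> q1' = q'" if "p < n" for p
          using keys[OF that] by simp
        then have "w1 = w" "q1' = q'"
          using n f(4,6) 4(4,6) by (auto intro!: tracks_code_inject[of K _ _ n] simp: less_imp_le)
        with f(7) show ?thesis by simp
      qed
    qed
    moreover from not_acc[OF 4(1) this] have "g N = End"
      using 4(7)[of N] n by (simp add: step_word_def)
    ultimately show ?case
      unfolding harmless_def using g n 4 by blast
  qed
qed

lemma word_End2:
  assumes "word (edge End2) g n"
  shows "g n = End2 \<or> word (edge End) g n"
  using assms
proof (induction n)
  case (Suc n)
  then show ?case
    by (cases "g n") (auto simp: word_Suc edge_def)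
qed (simp add: word_def)

lemma word_End_not_End2: "word (edge End) f n \<Longrightarrow> f n \<noteq> End2"
proof (induction n)
  case (Suc n)
  then show ?case
    by (cases "f n") (auto simp: word_Suc edge_def trans_letters_def split: if_splits)
qed (simp add: word_def)

lemma harmless_chain:
  assumes f: "word (edge End) f n" "f n = Chain 0" "f (Suc n) = End"
  shows "harmless c f (Suc n)"
proof -
  have eq: "f p = chain_word n End p" if "p \<le> n" for p
    using word_chain[OF f(1) _ f(2) that] by simp
  have n: "0 < n" using f by (cases n) (auto simp: word_def)
  with eq[of n] f(2) have "x < n" by (auto simp: chain_word_def)
  moreover have "f p = chain_word n End p" if "p \<le> Suc n" for p
    using eq[of p] that f(3) by (cases "p = Suc n") (auto simp: chain_word_def)
  ultimately show ?thesis
    using f n unfolding harmless_def by (intro conjI exI[of _ n]) (auto simp: word_Suc edge_simps)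
qed

lemma word_End:
  assumes "word (edge End) f n"
  shows "word (edge End2) f n \<or> harmless c f n"
  using assms
proof (induction n)
  case (Suc n)
  then have f: "word (edge End) f n" "edge End (f n) (f (Suc n))" by (simp_all add: word_Suc)
  from Suc.IH[OF f(1)] show ?case
  proof
    assume w: "word (edge End2) f n"
    show ?case
    proof (cases "f n = Chain 0 \<and> f (Suc n) = End")
      case True
      with f(1) show ?thesis using harmless_chain by blast
    next
      case False
      with f(2) have "edge End2 (f n) (f (Suc n))"
        by (cases "f n") (auto simp: edge_def)
      with w show ?thesis by (simp add: word_Suc)
    qed
  next
    assume h: "harmless c f n"
    then have "f n = End" by (simp add: harmless_def)
    with f(2) have "f = f(Suc n := End)" by (auto simp: edge_simps)
    with harmless_loop[OF h] show ?case by simp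
  qed
qed (simp add: word_def)

definition matched :: "'q \<times> (nat \<Rightarrow> nat) \<Rightarrow> (nat \<Rightarrow> 'q letter) \<Rightarrow> nat \<Rightarrow> (nat \<Rightarrow> 'q letter) \<Rightarrow> nat \<Rightarrow> bool" where
  "matched c f n g m \<longleftrightarrow>
    n = m \<and> (\<forall>p\<le>n. f p = g p) \<and> word (edge End) f n \<and> word (edge End2) f n \<or>
    harmless c f n \<and> word (edge End2) g m \<and> (g m = End2 \<or> harmless c g m)"

lemma matched_diagonal: "word (edge End) f n \<Longrightarrow> word (edge End2) f n \<Longrightarrow> matched c f n f n"
  by (simp add: matched_def)

lemma matched_words:
  assumes "matched c f n g m"
  shows "word (edge End) f n" "word (edge End2) g m" "lab (f n) = lab (g m)"
proof -
  have "word (edge End2) g n" if "\<forall>p\<le>n. f p = g p" "word (edge End2) f n"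
    using word_cong[of n f g] that by blast
  with assms show "word (edge End) f n" "word (edge End2) g m" "lab (f n) = lab (g m)"
    unfolding matched_def by (auto simp: harmless_def)
qed

lemma edge_End_End2:
  "edge End s t \<noteq> edge End2 s t \<Longrightarrow> s = Chain 0 \<and> (edge End s t \<longrightarrow> t = End) \<and> (edge End2 s t \<longrightarrow> t = End2)"
  by (cases s) (auto simp: edge_def)

lemma matched_extend_same:
  assumes "\<forall>p\<le>n. f p = g p" "word (edge End) f n" "word (edge End2) f n"
    "edge End (f n) t" "edge End2 (f n) t"
  shows "matched c (f(Suc n := t)) (Suc n) (g(Suc n := t)) (Suc n)"
  using assms by (auto simp: matched_def word_snoc)

lemma matched_extend_chain:
  assumes "\<forall>p\<le>n. f p = g p" "word (edge End) f n" "word (edge End2) f n" "f n = Chain 0"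
  shows "matched c (f(Suc n := End)) (Suc n) (g(Suc n := End2)) (Suc n)"
proof -
  have "harmless c (f(Suc n := End)) (Suc n)"
    using assms(2,4) word_cong[of n "f(Suc n := End)" f] by (intro harmless_chain) auto
  moreover have "word (edge End2) (g(Suc n := End2)) (Suc n)"
    using assms word_cong[of n f g] unfolding word_snoc by (auto simp: edge_simps)
  ultimately show ?thesis by (simp add: matched_def)
qed

lemma matched_extend_harmless:
  assumes "harmless c f n" "word (edge End2) g m" "g m = End2 \<or> harmless c g m"
  shows "matched c (f(Suc n := End)) (Suc n) (g(Suc m := g m)) (Suc m)"
proof -
  have "g m = End2 \<or> g m = End" using assms(3) by (auto simp: harmless_def)
  then have "word (edge End2) (g(Suc m := g m)) (Suc m)"
    using assms(2) unfolding word_snoc by (auto simp: edge_simps)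
  moreover have "harmless c g m \<Longrightarrow> harmless c (g(Suc m := g m)) (Suc m)"
    using harmless_loop[of c g m] by (simp add: harmless_def)
  ultimately show ?thesis
    using assms harmless_loop[OF assms(1)] by (auto simp: matched_def)
qed

lemma matched_successor:
  assumes "matched c f n g m" "edge End2 (g m) t"
  shows "\<exists>s. edge End (f n) s \<and> matched c (f(Suc n := s)) (Suc n) (g(Suc m := t)) (Suc m)"
proof -
  from assms(1) consider "n = m \<and> (\<forall>p\<le>n. f p = g p) \<and> word (edge End) f n \<and> word (edge End2) f n"
    | "harmless c f n \<and> word (edge End2) g m \<and> (g m = End2 \<or> harmless c g m)"
    unfolding matched_def by blast
  then show ?thesis
  proof cases
    case 1
    then have f: "n = m" "\<forall>p\<le>n. f p = g p" "word (edge End) f n" "word (edge End2) f n" by blast+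
    then have "edge End2 (f n) t" using assms(2) by simp
    show ?thesis
    proof (cases "edge End (f n) t")
      case True
      with matched_extend_same[where c = c, OF f(2-4) True \<open>edge End2 (f n) t\<close>] f(1) show ?thesis by blast
    next
      case False
      with \<open>edge End2 (f n) t\<close> have "f n = Chain 0" "t = End2"
        using edge_End_End2[of "f n" t] by auto
      with matched_extend_chain[where c = c, OF f(2-4)] f(1) show ?thesis
        by (intro exI[of _ End]) (auto simp: edge_simps)
    qed
  next
    case 2
    then have f: "harmless c f n" "word (edge End2) g m" "g m = End2 \<or> harmless c g m" by blast+
    then have "f n = End" "g m = End2 \<or> g m = End" by (auto simp: harmless_def)
    with assms(2) have "t = g m" by (auto simp: edge_simps)
    with matched_extend_harmless[OF f] \<open>f n = End\<close> show ?thesis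
      by (intro exI[of _ End]) (simp add: edge_simps)
  qed
qed

lemma matched_successor':
  assumes "matched c f n g m" "edge End (f n) t"
  shows "\<exists>s. edge End2 (g m) s \<and> matched c (f(Suc n := t)) (Suc n) (g(Suc m := s)) (Suc m)"
proof -
  from assms(1) consider "n = m \<and> (\<forall>p\<le>n. f p = g p) \<and> word (edge End) f n \<and> word (edge End2) f n"
    | "harmless c f n \<and> word (edge End2) g m \<and> (g m = End2 \<or> harmless c g m)"
    unfolding matched_def by blast
  then show ?thesis
  proof cases
    case 1
    then have f: "n = m" "\<forall>p\<le>n. f p = g p" "word (edge End) f n" "word (edge End2) f n" by blast+
    then have fg: "f n = g m" by simp
    show ?thesis
    proof (cases "edge End2 (f n) t")
      case True
      with matched_extend_same[where c = c, OF f(2-4) assms(2) True] f(1) fg show ?thesis by auto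
    next
      case False
      with assms(2) have "f n = Chain 0" "t = End"
        using edge_End_End2[of "f n" t] by auto
      with matched_extend_chain[where c = c, OF f(2-4)] f(1) fg show ?thesis
        by (intro exI[of _ End2]) (auto simp: edge_simps)
    qed
  next
    case 2
    then have f: "harmless c f n" "word (edge End2) g m" "g m = End2 \<or> harmless c g m" by blast+
    then have "f n = End" "g m = End2 \<or> g m = End" by (auto simp: harmless_def)
    with assms(2) matched_extend_harmless[OF f] show ?thesis
      by (intro exI[of _ "g m"]) (auto simp: edge_simps)
  qed
qed

lemma matched_neighbour:
  assumes c: "step\<^sup>*\<^sup>* (q0, input x) c" "fst c \<noteq> acc" "\<nexists>d. step c d"
    and R: "matched c f n g m" and i: "i \<in> {0, 1}"
    and g': "word (edge End2) g' m" "\<forall>p\<le>m. key i (g p) = key i (g' p)"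
  shows "\<exists>f'. word (edge End) f' n \<and> (\<forall>p\<le>n. key i (f p) = key i (f' p)) \<and> matched c f' n g' m"
  using R unfolding matched_def[of c f n g m]
proof (elim disjE conjE)
  assume f: "n = m" "\<forall>p\<le>n. f p = g p" "word (edge End) f n" "word (edge End2) f n"
  have "g' m \<noteq> End2"
  proof
    assume "g' m = End2"
    then have "key i (g m) = End2" using g'(2) by (simp add: key_eq)
    then have "f n = End2" using f(1,2) by (simp add: key_eq)
    with word_End_not_End2[OF f(3)] show False by simp
  qed
  with word_End2[OF g'(1)] have "word (edge End) g' m" by blast
  with f g' matched_diagonal[of g' m c] show ?thesis by (intro exI[of _ g']) auto
next
  assume f: "harmless c f n" "word (edge End2) g m" "g m = End2"
  then have "g' m = End2" using g'(2) by (metis key_eq(2) order_refl)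
  with f g' show ?thesis by (intro exI[of _ f]) (auto simp: matched_def harmless_def)
next
  assume f: "harmless c f n" "word (edge End2) g m" "harmless c g m"
  then have "key i (g' m) = End" using g'(2) by (auto simp: harmless_def key_eq)
  then have "g' m \<noteq> End2" by (auto simp: key_eq)
  with word_End2[OF g'(1)] have "word (edge End) g' m" by blast
  from harmless_neighbour[OF f(3) this i g'(2) c] f g' show ?thesis
    by (intro exI[of _ f]) (auto simp: matched_def harmless_def)
qed

lemma matched_neighbour':
  assumes c: "step\<^sup>*\<^sup>* (q0, input x) c" "fst c \<noteq> acc" "\<nexists>d. step c d"
    and R: "matched c f n g m" and i: "i \<in> {0, 1}"
    and f': "word (edge End) f' n" "\<forall>p\<le>n. key i (f p) = key i (f' p)"
  shows "\<exists>g'. word (edge End2) g' m \<and> (\<forall>p\<le>m. key i (g p) = key i (g' p)) \<and> matched c f' n g' m"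
proof -
  have closed: "harmless c g' n" if "harmless c f n" "word (edge End) g' n" "\<forall>p\<le>n. key i (f p) = key i (g' p)"
    for f g' n
    using harmless_neighbour[OF that(1,2) i that(3) c] .
  show ?thesis
    using R unfolding matched_def[of c f n g m]
  proof (elim disjE conjE)
    assume f: "n = m" "\<forall>p\<le>n. f p = g p" "word (edge End) f n" "word (edge End2) f n"
    from word_End[OF f'(1), of c] show ?thesis
    proof
      assume "word (edge End2) f' n"
      with f f' matched_diagonal[of f' n c] show ?thesis by (intro exI[of _ f']) auto
    next
      assume h: "harmless c f' n"
      with closed[OF h f(3)] f' have "harmless c f n" by auto
      with h f show ?thesis by (intro exI[of _ f]) (auto simp: matched_def)
    qed
  next
    assume f: "harmless c f n" "word (edge End2) g m" "g m = End2"
    with closed[OF f(1) f'] show ?thesis by (intro exI[of _ g]) (auto simp: matched_def)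
  next
    assume f: "harmless c f n" "word (edge End2) g m" "harmless c g m"
    with closed[OF f(1) f'] show ?thesis by (intro exI[of _ g]) (auto simp: matched_def)
  qed
qed

theorem bisimilar_if_rejects:
  assumes c: "step\<^sup>*\<^sup>* (q0, input x) c" "fst c \<noteq> acc" "\<nexists>d. step c d"
  shows "bisimilar {0, 1} (game (edge End)) (game (edge End2))"
proof -
  let ?R = "{(run f n, run g m) | f n g m. matched c f n g m}"
  have E: "edges_within (edge End)" "edges_within (edge End2)"
    by (simp_all add: edges_within)
  have sim: "simulation {0, 1} (game (edge End)) (game (edge End2)) ?R"
  proof (rule simulationI[OF E], goal_cases)
    case (1 f n g m)
    from matched_words[OF this] show ?case by simp
  next
    case (2 f n g m i g')
    from matched_neighbour[OF c this] show ?case .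
  next
    case (3 f n g m t)
    from matched_successor[OF this] show ?case .
  qed
  have "simulation {0, 1} (game (edge End2)) (game (edge End))
      {(run f n, run g m) | f n g m. matched c g m f n}"
  proof (rule simulationI[OF E(2,1)], goal_cases)
    case (1 f n g m)
    from matched_words[OF this] show ?case by simp
  next
    case (2 f n g m i g')
    from matched_neighbour'[OF c this] show ?case .
  next
    case (3 f n g m t)
    from matched_successor'[OF this] show ?case .
  qed
  moreover have "{(run f n, run g m) | f n g m. matched c g m f n} = ?R\<inverse>" by auto
  ultimately have sim': "simulation {0, 1} (game (edge End2)) (game (edge End)) (?R\<inverse>)" by (simp only:)
  have "matched c (\<lambda>_. Begin) 0 (\<lambda>_. Begin) 0"
    by (rule matched_diagonal) (simp_all add: word_def)
  then have "(run (\<lambda>_. Begin) 0, run (\<lambda>_. Begin) 0) \<in> ?R" by blast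
  then have "(Start (init (game (edge End))), Start (init (game (edge End2)))) \<in> ?R" by simp
  with sim sim' show ?thesis unfolding bisimilar_def bisimulation_def by (intro exI[of _ ?R] conjI)
qed

end

context machine_input
begin

subsection \<open>Distinguishing the games of an accepted input\<close>

definition idle_word :: "'q \<times> (nat \<Rightarrow> nat) \<Rightarrow> nat \<Rightarrow> nat \<Rightarrow> 'q letter" where
  "idle_word c n = step_word (fst c) Nop (fst c) (snd c) (snd c) n"

lemma step_control: "step (q, v) (q', w) \<Longrightarrow> q \<in> control \<and> q' \<in> control"
  by (force simp: step_def control_def)

lemma steps_control:
  "step\<^sup>*\<^sup>* (q0, input x) (q, v) \<Longrightarrow> q \<in> control \<and> supported K v"
proof (induction rule: rtranclp_induct2)
  case refl
  show ?case using supported_input by (simp add: control_def)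
next
  case (step q v q' w)
  then show ?case using step_control effect_supported by (auto simp: step_def)
qed

lemma idle_word_word:
  "q \<in> control \<Longrightarrow> supported K v \<Longrightarrow> (\<And>j. v j < n) \<Longrightarrow> word (edge e) (idle_word (q, v) n) N"
  unfolding idle_word_def by (rule step_word_word) (auto simp: control_idle)

lemma supported_bounded:
  assumes "supported K v"
  shows "\<exists>n. \<forall>j. v j < n"
proof -
  have "v j \<le> (\<Sum>j<K. v j)" for j
    using assms by (cases "j < K") (auto intro: member_le_sum simp: supported_def)
  then show ?thesis using less_Suc_eq_le by blast
qed

theorem not_bisimilar_if_accepts:
  assumes "step\<^sup>*\<^sup>* (q0, input x) (acc, u)"
  shows "\<not> bisimilar {0, 1} (game (edge End)) (game (edge End2))"
proof
  assume "bisimilar {0, 1} (game (edge End)) (game (edge End2))"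
  then obtain R0 where R0: "simulation {0, 1} (game (edge End2)) (game (edge End)) (R0\<inverse>)"
    "(Start (enc Begin), Start (enc Begin)) \<in> R0"
    unfolding bisimilar_def bisimulation_def by auto
  define R where "R = R0\<inverse>"
  have E: "edges_within (edge End2)" "edges_within (edge End)" by (simp_all add: edges_within)
  note sim = simulationD[OF R0(1)[folded R_def] E]
  have follow: "\<exists>f. word (edge End2) f m \<and> (run f m, run g m) \<in> R" if "word (edge End) g m" for g m
    using that
  proof (induction m)
    case 0
    then show ?case using R0(2)
      by (intro exI[of _ "\<lambda>_. Begin"]) (simp add: word_def R_def)
  next
    case (Suc m)
    then have g: "word (edge End) g m" "edge End (g m) (g (Suc m))" by (simp_all add: word_Suc)
    with Suc.IH obtain f where f: "word (edge End2) f m" "(run f m, run g m) \<in> R" by blast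
    from sim(3)[OF f(1) g(1) f(2) g(2)] obtain s where
      "edge End2 (f m) s" "(run (f(Suc m := s)) (Suc m), run g (Suc m)) \<in> R" by auto
    moreover from this f(1) have "word (edge End2) (f(Suc m := s)) (Suc m)" unfolding word_snoc by blast
    ultimately show ?case by blast
  qed
  define tied where "tied n g \<longleftrightarrow> (\<exists>f. word (edge End2) f (Suc n) \<and> f (Suc n) = End2 \<and>
    (run f (Suc n), run g (Suc n)) \<in> R)" for n g
  have start: "tied n (chain_word n End)" if "x < n" for n
  proof -
    let ?g = "chain_word n End"
    have g: "word (edge End) ?g N" for N using chain_word_word[OF that] by simp
    from follow[OF g] obtain f where f: "word (edge End2) f n" "(run f n, run ?g n) \<in> R" by blast
    have gn: "?g n = Chain 0" "?g (Suc n) = End" using that by (simp_all add: chain_word_def)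
    from sim(1)[OF f(1) g f(2)] gn have "lab (f n) = {0}" by simp
    then obtain k where k: "f n = Chain k" by (cases "f n") auto
    have "edge End (?g n) End" using gn by (simp add: edge_simps)
    from sim(3)[OF f(1) g f(2) this] obtain s where
      s: "edge End2 (f n) s" "(run (f(Suc n := s)) (Suc n), run (?g(Suc n := End)) (Suc n)) \<in> R" by blast
    have gE: "?g(Suc n := End) = ?g" using gn(2) by (metis fun_upd_triv)
    have f': "word (edge End2) (f(Suc n := s)) (Suc n)" using f(1) s(1) unfolding word_snoc by blast
    from sim(1)[OF f' g s(2)[unfolded gE]] gn(2) have "lab s = {1}" by simp
    moreover have "edge End2 (Chain k) s" using s(1) unfolding k .
    then have "s = End2 \<or> (\<exists>j. s = Chain j)" by (cases k) (simp_all only: edge_simps, blast+)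
    moreover have "lab (Chain j) \<noteq> {1}" for j by simp
    ultimately have "s = End2" by metis
    with f' s(2)[unfolded gE] show ?thesis
      unfolding tied_def by (intro exI[of _ "f(Suc n := s)"] conjI) simp_all
  qed
  have neighbour: "tied n g'" if t: "tied n g" "i \<in> {0, 1}" "word (edge End) g (Suc n)"
    "word (edge End) g' (Suc n)" "\<And>p. p \<le> Suc n \<Longrightarrow> key i (g p) = key i (g' p)" for n g g' i
  proof -
    from t(1) obtain f where f: "word (edge End2) f (Suc n)" "f (Suc n) = End2"
      "(run f (Suc n), run g (Suc n)) \<in> R" unfolding tied_def by blast
    from sim(2)[OF f(1) t(3) f(3) t(2,4)] t(5) obtain f' where
      f': "word (edge End2) f' (Suc n)" "\<forall>p\<le>Suc n. key i (f p) = key i (f' p)"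
      "(run f' (Suc n), run g' (Suc n)) \<in> R" by blast
    from f(2) have "key i (f (Suc n)) = End2" by (simp add: key_eq)
    with f'(2) have "f' (Suc n) = End2" by (metis key_eq(2) order_refl)
    with f' show ?thesis unfolding tied_def by blast
  qed
  have "\<exists>b. \<forall>n\<ge>b. tied n (idle_word (q, v) n)" if "step\<^sup>*\<^sup>* (q0, input x) (q, v)" for q v
    using that
  proof (induction rule: rtranclp_induct2)
    case refl
    have "tied n (idle_word (q0, input x) n)" if n: "x < n" for n
    proof (rule neighbour[OF start[OF n], of 1])
      show "word (edge End) (idle_word (q0, input x) n) (Suc n)"
        using n by (intro idle_word_word supported_input) (auto simp: control_def input_def)
      fix p assume p: "p \<le> Suc n"
      show "key 1 (chain_word n End p) = key 1 (idle_word (q0, input x) n p)"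
      proof (cases "p = 0 \<or> n < p")
        case True
        then show ?thesis using q0_acc by (auto simp: chain_word_def idle_word_def step_word_def)
      next
        case False
        have 1: "tracks_code (input x) (p - 1) = (if p \<le> x then 1 else 0)"
        proof -
          have "tracks (input x) (p - 1) = (if p \<le> x then {0} else {})"
            using False by (auto simp: tracks_def input_def)
          then show ?thesis by (simp add: tracks_code_def)
        qed
        have 2: "Suc x - p = (if p \<le> x then Suc (x - p) else 0)" by auto
        show ?thesis
          using False by (simp add: chain_word_def idle_word_def step_word_def 1[simplified] 2)
      qed
    qed (use chain_word_word[OF n] in simp_all)
    then show ?case by (metis Suc_le_lessD)
  next
    case (step q v q' w)
    from step.IH obtain b where b: "\<forall>n\<ge>b. tied n (idle_word (q, v) n)" by blast
    have sup: "q \<in> control" "supported K v" "q' \<in> control" "supported K w"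
      using steps_control step.hyps rtranclp.rtrancl_into_rtrancl[OF step.hyps] by blast+
    obtain bv bw where bv: "\<forall>j. v j < bv" and bw: "\<forall>j. w j < bw"
      using supported_bounded sup by metis
    from step.hyps(2) obtain k where k: "(q, k, q') \<in> \<Delta>" "effect k v w" by (auto simp: step_def)
    have q: "q \<noteq> acc" using k no_out by auto
    have "tied n (idle_word (q', w) n)" if n: "n \<ge> max b (max bv bw)" for n
    proof -
      have v: "v j < n" and w: "w j < n" for j
        using bv bw n by (meson le_trans less_le_trans max.cobounded1 max.cobounded2 max.bounded_iff)+
      let ?s = "step_word q k q' v w n"
      have s: "word (edge End) ?s N" for N
        using k sup v w by (intro step_word_word) (auto simp: edges_def)
      have idle: "word (edge End) (idle_word (q, v) n) N" "word (edge End) (idle_word (q', w) n) N" for N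
        using sup v w by (auto intro: idle_word_word)
      have "tied n (idle_word (q, v) n)" using b n by simp
      then have "tied n ?s"
        by (rule neighbour[where i = 0, OF _ _ idle(1) s]) (use q in \<open>auto simp: idle_word_def step_word_def\<close>)
      then show ?thesis
        by (rule neighbour[where i = 1, OF _ _ s idle(2)]) (use q in \<open>auto simp: idle_word_def step_word_def\<close>)
    qed
    then show ?case by blast
  qed
  from this[OF assms] obtain b where b: "\<forall>n\<ge>b. tied n (idle_word (acc, u) n)" by blast
  obtain bu where bu: "\<forall>j. u j < bu" using steps_control[OF assms] supported_bounded by blast
  define n where "n = max b bu"
  have "u j < n" for j using bu by (simp add: n_def less_max_iff_disj)
  then have w: "word (edge End) (idle_word (acc, u) n) (Suc n)"
    using steps_control[OF assms] by (intro idle_word_word) auto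
  have "tied n (idle_word (acc, u) n)" using b by (simp add: n_def)
  then obtain f where f: "word (edge End2) f (Suc n)" "f (Suc n) = End2"
    "(run f (Suc n), run (idle_word (acc, u) n) (Suc n)) \<in> R" unfolding tied_def by blast
  from sim(1)[OF f(1) w f(3)] f(2) show False
    by (simp add: idle_word_def step_word_def)
qed

end

subsection \<open>The codes of the games\<close>

definition act_code :: nat where
  "act_code = joint_code {0, 1} idle"

lemma set_encode_Un:
  "finite A \<Longrightarrow> finite B \<Longrightarrow> A \<inter> B = {} \<Longrightarrow> set_encode (A \<union> B) = set_encode A + set_encode B"
  unfolding set_encode_def by (rule sum.union_disjoint)

lemma set_encode_image: "inj_on f A \<Longrightarrow> set_encode (f ` A) = (\<Sum>a\<in>A. 2 ^ f a)"
  unfolding set_encode_def by (simp add: sum.reindex)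

lemma set_encode_extend:
  fixes f :: "nat \<Rightarrow> nat"
  assumes "finite A" "inj f" "\<And>j. f j \<notin> A"
  shows "set_encode (A \<union> f ` {..<n}) = set_encode A + (\<Sum>j<n. 2 ^ f j)"
proof -
  have "inj_on f {..<n}" using assms(2) by (rule inj_on_subset) simp
  from set_encode_image[OF this]
  have "set_encode (f ` {..<n}) = (\<Sum>j<n. 2 ^ f j)" .
  moreover have "set_encode (A \<union> f ` {..<n}) = set_encode A + set_encode (f ` {..<n})"
    using assms(1,3) by (intro set_encode_Un) auto
  ultimately show ?thesis by simp
qed

context machine
begin

lemma enc_eq: "enc s = enc t \<longleftrightarrow> s = t"
  using inj_enc by (auto dest: injD)

definition base_states :: "nat set" where
  "base_states = enc ` base"

definition base_indist :: "nat set" where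
  "base_indist = {prod_encode (i, prod_encode (enc s, enc t)) | i s t.
    i \<in> {0, 1} \<and> s \<in> base \<and> t \<in> base \<and> key i s = key i t}"

definition base_protocol :: "nat set" where
  "base_protocol = {prod_encode (i, prod_encode (enc s, 0)) | i s. i \<in> {0, 1} \<and> s \<in> base}"

definition base_transitions :: "'q letter \<Rightarrow> nat set" where
  "base_transitions e = {prod_encode (enc s, prod_encode (act_code, enc t)) | s t. base_edge e s t}"

definition base_labels :: "nat set" where
  "base_labels = {prod_encode (enc s, p) | s p. s \<in> base \<and> p \<in> lab s}"

lemma Chain_not_base: "Chain (Suc j) \<notin> base"
  by (auto simp: base_def trans_letters_def)

lemma mark_base: "mark \<in> base"
proof -
  have "set_decode 1 = {0}" using set_encode_inverse[of "{0}"] by simp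
  with K show ?thesis by (simp add: base_def trans_letters_def mark_def edges_def control_def)
qed

lemma key_mark:
  assumes "t \<in> base"
  shows "key (Suc 0) t = mark \<longleftrightarrow> t = mark"
proof (cases t)
  case (Trans q i q' a b)
  then have T: "(q, i, q') \<in> edges" "everywhere i (set_decode a) (set_decode b)"
    using assms by (auto simp: base_def trans_letters_def)
  show ?thesis
  proof
    assume "key (Suc 0) t = mark"
    then have "q' = q0" "b = 1" using Trans by (auto simp: mark_def)
    with T have "i = Nop" "q = q0" using edges_q0 by blast+
    with T(2) have "a = b" by (metis everywhere.simps(1) set_decode_inverse)
    with \<open>i = Nop\<close> \<open>q = q0\<close> \<open>q' = q0\<close> \<open>b = 1\<close> Trans show "t = mark" by (simp add: mark_def)
  qed (simp add: mark_def)
qed (use assms Chain_not_base in \<open>auto simp: mark_def base_def trans_letters_def\<close>)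

lemma base_edge_base: "e \<in> {End, End2} \<Longrightarrow> base_edge e s t \<Longrightarrow> s \<in> base \<and> t \<in> base"
  by (cases s) (auto simp: base_def split: if_splits)

lemma finite_base_codes:
  "finite base_states" "finite base_indist" "finite base_protocol"
  "e \<in> {End, End2} \<Longrightarrow> finite (base_transitions e)" "finite base_labels"
proof -
  note fin = finite_base
  show "finite base_states" by (simp add: base_states_def fin)
  have "base_indist \<subseteq> (\<lambda>(i, s, t). prod_encode (i, prod_encode (enc s, enc t))) ` ({0, 1} \<times> base \<times> base)"
    by (force simp: base_indist_def)
  then show "finite base_indist" by (rule finite_subset) (simp add: fin)
  have "base_protocol \<subseteq> (\<lambda>(i, s). prod_encode (i, prod_encode (enc s, 0))) ` ({0, 1} \<times> base)"
    by (force simp: base_protocol_def)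
  then show "finite base_protocol" by (rule finite_subset) (simp add: fin)
  show "finite (base_transitions e)" if "e \<in> {End, End2}"
  proof (rule finite_subset)
    show "base_transitions e \<subseteq> (\<lambda>(s, t). prod_encode (enc s, prod_encode (act_code, enc t))) ` (base \<times> base)"
      using base_edge_base[OF that] by (force simp: base_transitions_def)
  qed (simp add: fin)
  have "base_labels \<subseteq> (\<lambda>(s, p). prod_encode (enc s, p)) ` (base \<times> {0, 1, 2})"
  proof
    fix y assume "y \<in> base_labels"
    then obtain s p where y: "y = prod_encode (enc s, p)" "s \<in> base" "p \<in> lab s"
      unfolding base_labels_def by blast
    from y(3) have "p \<in> {0, 1, 2}" by (cases s) auto
    with y show "y \<in> (\<lambda>(s, p). prod_encode (enc s, p)) ` (base \<times> {0, 1, 2})"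
      by (intro image_eqI[of _ _ "(s, p)"]) simp_all
  qed
  then show "finite base_labels" by (rule finite_subset) (simp add: fin)
qed

end

context machine_input
begin

lemma letters_split: "letters = base \<union> (\<lambda>j. Chain (Suc j)) ` {..<x}"
proof -
  have "{..x} = insert 0 (Suc ` {..<x})" 
    by (simp only: lessThan_Suc_atMost[symmetric] lessThan_Suc_eq_insert_0)
  moreover have "Chain 0 \<in> base" by (simp add: base_def)
  ultimately show ?thesis by (auto simp: letters_def image_image)
qed

abbreviation chain :: "nat \<Rightarrow> nat" where
  "chain j \<equiv> enc (Chain (Suc j))"

lemma states_code: "set_encode (enc ` letters) = set_encode base_states + (\<Sum>j<x. 2 ^ chain j)"
proof -
  have "enc ` letters = base_states \<union> chain ` {..<x}"
    by (auto simp: letters_split base_states_def)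
  moreover have "inj (\<lambda>j. chain j)" by (simp add: inj_def enc_eq)
  moreover have "chain j \<notin> base_states" for j
    using Chain_not_base by (auto simp: base_states_def enc_eq)
  ultimately show ?thesis by (simp add: set_encode_extend finite_base_codes)
qed

lemma indist_code:
  "set_encode {prod_encode (i, prod_encode (s, t)) | i s t. i \<in> {0, 1} \<and> (s, t) \<in> indist (game E) i} =
    set_encode base_indist
    + (\<Sum>j<x. 2 ^ prod_encode (0, prod_encode (chain j, chain j)))
    + (\<Sum>j<x. \<Sum>k<x. 2 ^ prod_encode (1, prod_encode (chain j, chain k)))
    + (\<Sum>j<x. 2 ^ prod_encode (1, prod_encode (chain j, enc mark)))
    + (\<Sum>j<x. 2 ^ prod_encode (1, prod_encode (enc mark, chain j)))"
proof -
  let ?A = "(\<lambda>j. prod_encode (0, prod_encode (chain j, chain j))) ` {..<x}"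
  let ?B = "(\<lambda>(j, k). prod_encode (1, prod_encode (chain j, chain k))) ` ({..<x} \<times> {..<x})"
  let ?C = "(\<lambda>j. prod_encode (1, prod_encode (chain j, enc mark))) ` {..<x}"
  let ?D = "(\<lambda>j. prod_encode (1, prod_encode (enc mark, chain j))) ` {..<x}"
  have mark: "mark \<noteq> Chain j" for j by (simp add: mark_def)
  have key0: "key 0 (Chain (Suc j)) = key 0 t \<longleftrightarrow> t = Chain (Suc j)"
    "key 0 t = key 0 (Chain (Suc j)) \<longleftrightarrow> t = Chain (Suc j)" for j t
    by (auto simp: key_eq)
  have key1: "key (Suc 0) (Chain (Suc j)) = mark" for j by (simp add: mark_def)
  have "{prod_encode (i, prod_encode (s, t)) | i s t. i \<in> {0, 1} \<and> (s, t) \<in> indist (game E) i} =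
      {prod_encode (i, prod_encode (enc s, enc t)) | i s t. i \<in> {0, 1} \<and> s \<in> letters \<and> t \<in> letters \<and> key i s = key i t}"
    unfolding game_def by (simp, blast)
  also have "\<dots> = base_indist \<union> ?A \<union> ?B \<union> ?C \<union> ?D"
  proof (intro equalityI subsetI)
    fix y assume "y \<in> {prod_encode (i, prod_encode (enc s, enc t)) | i s t.
      i \<in> {0, 1} \<and> s \<in> letters \<and> t \<in> letters \<and> key i s = key i t}"
    then obtain i s t where y: "y = prod_encode (i, prod_encode (enc s, enc t))" "i \<in> {0, 1}"
      "s \<in> letters" "t \<in> letters" "key i s = key i t" by blast
    consider "s \<in> base" "t \<in> base" | j where "s \<in> base" "t = Chain (Suc j)" "j < x"
      | j where "s = Chain (Suc j)" "t \<in> base" "j < x"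
      | j k where "s = Chain (Suc j)" "t = Chain (Suc k)" "j < x" "k < x"
      using y(3,4) by (auto simp: letters_split)
    then show "y \<in> base_indist \<union> ?A \<union> ?B \<union> ?C \<union> ?D"
    proof cases
      case 1
      with y show ?thesis by (auto simp: base_indist_def)
    next
      case 2
      have "i \<noteq> 0"
      proof
        assume "i = 0"
        with y(5) 2 have "s = Chain (Suc j)" by (simp add: key_eq)
        with 2 Chain_not_base show False by blast
      qed
      with y(2) have "i = Suc 0" by simp
      with y(5) 2 have "s = mark" using key1 key_mark by metis
      with y(1) 2 \<open>i = Suc 0\<close> show ?thesis by auto
    next
      case 3
      have "i \<noteq> 0"
      proof
        assume "i = 0"
        with y(5) 3 have "t = Chain (Suc j)" by (simp add: key_eq)
        with 3 Chain_not_base show False by blast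
      qed
      with y(2) have "i = Suc 0" by simp
      with y(5) 3 have "t = mark" using key1 key_mark by metis
      with y(1) 3 \<open>i = Suc 0\<close> show ?thesis by auto
    next
      case 4
      with y(1,2,5) show ?thesis by (auto simp: key0)
    qed
  next
    let ?L = "{prod_encode (i, prod_encode (enc s, enc t)) | i s t.
        i \<in> {0, 1} \<and> s \<in> letters \<and> t \<in> letters \<and> key i s = key i t}"
    have L: "prod_encode (i, prod_encode (enc s, enc t)) \<in> ?L"
      if "i \<in> {0, 1}" "s \<in> letters" "t \<in> letters" "key i s = key i t" for i s t
      using that by blast
    have chain: "Chain (Suc j) \<in> letters" if "j < x" for j
      using that by (simp add: letters_split)
    have base: "mark \<in> letters" "base \<subseteq> letters" using mark_base by (auto simp: letters_split)
    have key1': "key 1 (Chain (Suc j)) = mark" "key 1 mark = mark" for j by (simp_all add: mark_def)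
    fix y assume "y \<in> base_indist \<union> ?A \<union> ?B \<union> ?C \<union> ?D"
    then consider "y \<in> base_indist" | "y \<in> ?A" | "y \<in> ?B" | "y \<in> ?C" | "y \<in> ?D" by blast
    then show "y \<in> ?L"
    proof cases
      case 1
      then show ?thesis using base(2) unfolding base_indist_def by blast
    next
      case 2
      then obtain j where "j < x" "y = prod_encode (0, prod_encode (chain j, chain j))" by auto
      then show ?thesis using L[OF _ chain chain] by simp
    next
      case 3
      then obtain j k where "j < x" "k < x" "y = prod_encode (1, prod_encode (chain j, chain k))" by auto
      then show ?thesis using L[of 1, OF _ chain chain] key1' by (simp only: insert_iff simp_thms)
    next
      case 4
      then obtain j where "j < x" "y = prod_encode (1, prod_encode (chain j, enc mark))" by auto
      then show ?thesis using L[of 1, OF _ chain base(1)] key1' by (simp only: insert_iff simp_thms)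
    next
      case 5
      then obtain j where "j < x" "y = prod_encode (1, prod_encode (enc mark, chain j))" by auto
      then show ?thesis using L[of 1, OF _ base(1) chain] key1' by (simp only: insert_iff simp_thms)
    qed
  qed
  finally have eq: "{prod_encode (i, prod_encode (s, t)) | i s t. i \<in> {0, 1} \<and> (s, t) \<in> indist (game E) i} =
      base_indist \<union> ?A \<union> ?B \<union> ?C \<union> ?D" .
  have inj: "inj_on (\<lambda>(j, k). prod_encode (1, prod_encode (chain j, chain k))) ({..<x} \<times> {..<x})"
    by (auto simp: inj_on_def enc_eq)
  have "set_encode (base_indist \<union> ?A) = set_encode base_indist +
      (\<Sum>j<x. 2 ^ prod_encode (0, prod_encode (chain j, chain j)))"
    using Chain_not_base
    by (intro set_encode_extend finite_base_codes) (auto simp: base_indist_def enc_eq inj_def)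
  moreover have "set_encode (base_indist \<union> ?A \<union> ?B) = set_encode (base_indist \<union> ?A) + set_encode ?B"
    using Chain_not_base
    by (intro set_encode_Un finite_UnI finite_base_codes finite_imageI finite_lessThan
        finite_cartesian_product) (auto simp: base_indist_def enc_eq finite_base_codes)
  moreover have "set_encode ?B = (\<Sum>j<x. \<Sum>k<x. 2 ^ prod_encode (1, prod_encode (chain j, chain k)))"
    unfolding set_encode_image[OF inj] by (simp only: sum.cartesian_product) (auto intro!: sum.cong)
  moreover have "set_encode (base_indist \<union> ?A \<union> ?B \<union> ?C) = set_encode (base_indist \<union> ?A \<union> ?B) +
      (\<Sum>j<x. 2 ^ prod_encode (1, prod_encode (chain j, enc mark)))"
    using Chain_not_base mark
    by (intro set_encode_extend finite_UnI finite_base_codes finite_imageI finite_lessThan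
        finite_cartesian_product) (auto simp: base_indist_def enc_eq inj_def finite_base_codes)
  moreover have "set_encode (base_indist \<union> ?A \<union> ?B \<union> ?C \<union> ?D) = set_encode (base_indist \<union> ?A \<union> ?B \<union> ?C) +
      (\<Sum>j<x. 2 ^ prod_encode (1, prod_encode (enc mark, chain j)))"
    using Chain_not_base mark mark[symmetric]
    by (intro set_encode_extend finite_UnI finite_base_codes finite_imageI finite_lessThan
        finite_cartesian_product) (auto simp: base_indist_def enc_eq inj_def finite_base_codes)
  ultimately show ?thesis unfolding eq by (simp only:)
qed

lemma protocol_code:
  "set_encode {prod_encode (i, prod_encode (s, c)) | i s c. i \<in> {0, 1} \<and> s \<in> enc ` letters \<and> c \<in> {0}} =
    set_encode base_protocol
    + (\<Sum>j<x. 2 ^ prod_encode (0, prod_encode (chain j, 0)))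
    + (\<Sum>j<x. 2 ^ prod_encode (1, prod_encode (chain j, 0)))"
proof -
  let ?A = "\<lambda>i::nat. (\<lambda>j. prod_encode (i, prod_encode (chain j, 0))) ` {..<x}"
  have eq: "{prod_encode (i, prod_encode (s, c)) | i s c. i \<in> {0, 1} \<and> s \<in> enc ` letters \<and> c \<in> {0}} =
      base_protocol \<union> ?A 0 \<union> ?A 1"
    by (auto simp: base_protocol_def letters_split enc_eq)
  have "set_encode (base_protocol \<union> ?A 0) =
      set_encode base_protocol + (\<Sum>j<x. 2 ^ prod_encode (0, prod_encode (chain j, 0)))"
    using Chain_not_base
    by (intro set_encode_extend finite_base_codes) (auto simp: base_protocol_def enc_eq inj_def)
  moreover have "set_encode (base_protocol \<union> ?A 0 \<union> ?A 1) =
      set_encode (base_protocol \<union> ?A 0) + (\<Sum>j<x. 2 ^ prod_encode (1, prod_encode (chain j, 0)))"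
    using Chain_not_base
    by (intro set_encode_extend finite_UnI finite_base_codes finite_imageI finite_lessThan
        finite_cartesian_product) (auto simp: base_protocol_def enc_eq inj_def finite_base_codes)
  ultimately show ?thesis unfolding eq by (simp only:)
qed

lemma transitions_code:
  assumes "e \<in> {End, End2}"
  shows "set_encode {prod_encode (s, prod_encode (joint_code {0, 1} a, t)) | s a t.
      (s, a, t) \<in> transitions (game (edge e))} =
    set_encode (base_transitions e)
    + 2 ^ prod_encode (1, prod_encode (act_code, 2 * x))
    + (\<Sum>j<x. 2 ^ prod_encode (chain j, prod_encode (act_code, 2 * j)))"
proof -
  let ?A = "(\<lambda>j. prod_encode (chain j, prod_encode (act_code, enc (Chain j)))) ` {..<x}"
  let ?B = "{prod_encode (enc Begin, prod_encode (act_code, enc (Chain x)))}"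
  have eq: "{prod_encode (s, prod_encode (joint_code {0, 1} a, t)) | s a t.
      (s, a, t) \<in> transitions (game (edge e))} = base_transitions e \<union> ?B \<union> ?A"
  proof -
    have "{prod_encode (s, prod_encode (joint_code {0, 1} a, t)) | s a t.
        (s, a, t) \<in> transitions (game (edge e))} =
        {prod_encode (enc s, prod_encode (act_code, enc t)) | s t. edge e s t}"
      unfolding transitions_game act_code_def by blast
    also have "\<dots> = base_transitions e \<union> ?B \<union> ?A"
      unfolding edge_def base_transitions_def by blast
    finally show ?thesis .
  qed
  have disj: "base_transitions e \<inter> ?B = {}"
    by (auto simp: base_transitions_def enc_eq trans_letters_def)
  have "set_encode (base_transitions e \<union> ?B) = set_encode (base_transitions e) + set_encode ?B"
    by (intro set_encode_Un finite_base_codes assms disj) simp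
  moreover have "set_encode ?B = 2 ^ prod_encode (enc Begin, prod_encode (act_code, enc (Chain x)))"
    by (simp add: set_encode_def)
  moreover have "set_encode (base_transitions e \<union> ?B \<union> ?A) = set_encode (base_transitions e \<union> ?B)
      + (\<Sum>j<x. 2 ^ prod_encode (chain j, prod_encode (act_code, enc (Chain j))))"
  proof (rule set_encode_extend)
    show "finite (base_transitions e \<union> ?B)" using finite_base_codes(4)[OF assms] by simp
    show "inj (\<lambda>j. prod_encode (chain j, prod_encode (act_code, enc (Chain j))))"
      by (simp add: inj_def enc_eq)
  qed (auto simp: base_transitions_def enc_eq)
  ultimately show ?thesis unfolding eq by (simp add: enc_simps)
qed

lemma labels_code:
  "set_encode {prod_encode (s, p) | s p. s \<in> enc ` letters \<and> p \<in> label (game E) s} =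
    set_encode base_labels + (\<Sum>j<x. 2 ^ prod_encode (chain j, 0))"
proof -
  let ?A = "(\<lambda>j. prod_encode (chain j, 0)) ` {..<x}"
  have eq: "{prod_encode (s, p) | s p. s \<in> enc ` letters \<and> p \<in> label (game E) s} = base_labels \<union> ?A"
  proof -
    have "{prod_encode (s, p) | s p. s \<in> enc ` letters \<and> p \<in> label (game E) s} =
        {prod_encode (enc s, p) | s p. s \<in> letters \<and> p \<in> lab s}"
      by auto
    also have "\<dots> = base_labels \<union> ?A"
      by (auto simp: base_labels_def letters_split enc_eq)
    finally show ?thesis .
  qed
  have "inj (\<lambda>j. prod_encode (chain j, 0))" by (simp add: inj_def enc_eq)
  moreover have "prod_encode (chain j, 0) \<notin> base_labels" for j
    using Chain_not_base by (auto simp: base_labels_def enc_eq)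
  ultimately show ?thesis unfolding eq by (simp add: set_encode_extend finite_base_codes)
qed

end

section \<open>The reduction\<close>

fun list_expr :: "expr list \<Rightarrow> expr" where
  "list_expr [] = Const 0"
| "list_expr (e # es) = Plus (Const 1) (Pair e (list_expr es))"

lemma eval_list_expr: "eval_expr (list_expr es) xs = list_encode (map (\<lambda>e. eval_expr e xs) es)"
  by (induction es) auto

lemma scoped_list_expr: "scoped n (list_expr es) \<longleftrightarrow> (\<forall>e\<in>set es. scoped n e)"
  by (induction es) auto

definition chain_expr :: "nat \<Rightarrow> expr" where
  "chain_expr j = Plus (Times (Const 2) (Var j)) (Const 2)"

text \<open>
  Variable \<open>0\<close> is the input \<open>x\<close> of the machine, the others are the codes of the parts of the
  game that do not depend on \<open>x\<close>; variable \<open>t\<close> is that of the transitions.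
\<close>

definition game_expr :: "nat \<Rightarrow> expr" where
  "game_expr t = list_expr
    [Const (set_encode {0, 1}),
     Plus (Var 1) (Sum (Var 0) (Pow2 (chain_expr 0))),
     Const 1,
     Const (set_encode {0}),
     Plus (Plus (Plus (Plus (Var 2)
       (Sum (Var 0) (Pow2 (Pair (Const 0) (Pair (chain_expr 0) (chain_expr 0))))))
       (Sum (Var 0) (Sum (Var 1) (Pow2 (Pair (Const 1) (Pair (chain_expr 1) (chain_expr 0)))))))
       (Sum (Var 0) (Pow2 (Pair (Const 1) (Pair (chain_expr 0) (Const 3))))))
       (Sum (Var 0) (Pow2 (Pair (Const 1) (Pair (Const 3) (chain_expr 0))))),
     Plus (Plus (Var 3)
       (Sum (Var 0) (Pow2 (Pair (Const 0) (Pair (chain_expr 0) (Const 0))))))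
       (Sum (Var 0) (Pow2 (Pair (Const 1) (Pair (chain_expr 0) (Const 0))))),
     Plus (Plus (Var t)
       (Pow2 (Pair (Const 1) (Pair (Const act_code) (Times (Const 2) (Var 0))))))
       (Sum (Var 0) (Pow2 (Pair (chain_expr 0) (Pair (Const act_code) (Times (Const 2) (Var 0)))))),
     Plus (Var 6) (Sum (Var 0) (Pow2 (Pair (chain_expr 0) (Const 0))))]"

definition input_expr :: expr where
  "input_expr = list_expr [game_expr 4, game_expr 5, Const (set_encode {0, 1})]"

lemma scoped_input_expr: "scoped 7 input_expr"
  by (simp add: input_expr_def game_expr_def scoped_list_expr chain_expr_def)

context machine
begin

definition parameters :: "nat list" where
  "parameters = [set_encode base_states, set_encode base_indist, set_encode base_protocol,
    set_encode (base_transitions End), set_encode (base_transitions End2), set_encode base_labels]"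

lemma length_parameters: "length parameters = 6"
  by (simp add: parameters_def)

end

context machine_input
begin

lemma game_code:
  assumes "e \<in> {End, End2}"
  shows "icgs_code (game (edge e)) = list_encode
    [set_encode {0, 1},
     set_encode base_states + (\<Sum>j<x. 2 ^ chain j),
     1,
     set_encode {0},
     set_encode base_indist
      + (\<Sum>j<x. 2 ^ prod_encode (0, prod_encode (chain j, chain j)))
      + (\<Sum>j<x. \<Sum>k<x. 2 ^ prod_encode (1, prod_encode (chain j, chain k)))
      + (\<Sum>j<x. 2 ^ prod_encode (1, prod_encode (chain j, 3)))
      + (\<Sum>j<x. 2 ^ prod_encode (1, prod_encode (3, chain j))),
     set_encode base_protocol
      + (\<Sum>j<x. 2 ^ prod_encode (0, prod_encode (chain j, 0)))
      + (\<Sum>j<x. 2 ^ prod_encode (1, prod_encode (chain j, 0))),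
     set_encode (base_transitions e)
      + 2 ^ prod_encode (1, prod_encode (act_code, 2 * x))
      + (\<Sum>j<x. 2 ^ prod_encode (chain j, prod_encode (act_code, 2 * j))),
     set_encode base_labels + (\<Sum>j<x. 2 ^ prod_encode (chain j, 0))]"
  unfolding icgs_code_def game_sel states_code indist_code protocol_code
    transitions_code[OF assms] labels_code enc_simps(2,3) ..

lemma input_code_expr:
  "input_code (game (edge End), game (edge End2), {0, 1}) = eval_expr input_expr (x # parameters)"
proof -
  have chain: "chain j = 2 * j + 2" for j by (simp add: enc_simps)
  have nth: "(x # parameters) ! 0 = x" "(x # parameters) ! 1 = set_encode base_states"
    "(x # parameters) ! 2 = set_encode base_indist" "(x # parameters) ! 3 = set_encode base_protocol"
    "(x # parameters) ! 4 = set_encode (base_transitions End)"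
    "(x # parameters) ! 5 = set_encode (base_transitions End2)"
    "(x # parameters) ! 6 = set_encode base_labels"
    by (simp_all add: parameters_def)
  have var: "(j # ys) ! 0 = j" "(j # ys) ! 1 = ys ! 0" for j and ys :: "nat list" by simp_all
  have "icgs_code (game (edge e)) = eval_expr (game_expr t) (x # parameters)"
    if "e \<in> {End, End2}" "(x # parameters) ! t = set_encode (base_transitions e)" for e t
    unfolding game_code[OF that(1)] game_expr_def eval_list_expr list.map chain_expr_def
      eval_expr.simps
    unfolding nth that(2) unfolding var chain ..
  from this[of End 4, OF _ nth(5)] this[of End2 5, OF _ nth(6)] show ?thesis
    by (simp add: input_expr_def eval_list_expr)
qed

lemma inputs: "(game (edge End), game (edge End2), {0, 1}) \<in> inputs"
proof -
  have "finite (lab s)" for s :: "'q letter" by (cases s) auto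
  then show ?thesis by (auto simp: inputs_def finite_icgs_edge)
qed

end

fun tuple :: "nat list \<Rightarrow> nat" where
  "tuple [] = 0"
| "tuple (a # as) = prod_encode (a, tuple as)"

lemma tuple_evaluates:
  "\<exists>gs. \<forall>as. length as = n \<longrightarrow> list_all2 (\<lambda>g y. evaluates g [tuple as] y) gs as"
proof (induction n)
  case 0
  show ?case by (intro exI[of _ "[]"]) simp
next
  case (Suc n)
  then obtain gs where gs: "\<And>as. length as = n \<Longrightarrow> list_all2 (\<lambda>g y. evaluates g [tuple as] y) gs as"
    by blast
  obtain p q where p: "\<And>a b. evaluates p [prod_encode (a, b)] a"
    and q: "\<And>a b. evaluates q [prod_encode (a, b)] b"
    using prod_decode_evaluates by blast
  have "list_all2 (\<lambda>g y. evaluates g [tuple as] y) (p # map (\<lambda>g. Comp g [q]) gs) as"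
    if l: "length as = Suc n" for as
  proof -
    from l obtain a as' where as: "as = a # as'" "length as' = n" by (cases as) auto
    have "list_all2 (\<lambda>g y. evaluates (Comp g [q]) [tuple as] y) gs as'"
      using gs[OF as(2)] by (rule list_all2_mono) (simp add: as(1) evaluates_Comp1[OF q])
    with p as(1) show ?thesis by (simp add: list.rel_map)
  qed
  then show ?case by blast
qed

lemma input_code_evaluates:
  "\<exists>r. \<forall>as. length as = 6 \<longrightarrow> evaluates r [tuple as] (eval_expr input_expr (tuple as # as))"
proof -
  obtain gs where gs: "\<And>as. length as = 6 \<Longrightarrow> list_all2 (\<lambda>g y. evaluates g [tuple as] y) gs as"
    using tuple_evaluates by blast
  obtain r where r: "\<And>xs. length xs = 7 \<Longrightarrow> evaluates r xs (eval_expr input_expr xs)"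
    using expr_evaluates[OF scoped_input_expr] by blast
  have "evaluates (Comp r (Proj 0 # gs)) [tuple as] (eval_expr input_expr (tuple as # as))"
    if "length as = 6" for as
    using gs[OF that] r[of "tuple as # as"] that
    by (intro evaluates.Comp[where ys = "tuple as # as"]) (auto intro: evaluates_Proj')
  then show ?thesis by blast
qed

subsection \<open>The machine of a program\<close>

datatype control = Initial | Running com | Accepting

instance com :: countable by countable_datatype
instance control :: countable by countable_datatype

definition machine_edges :: "com \<Rightarrow> (control \<times> instr \<times> control) set" where
  "machine_edges c = {(Initial, Nop, Running c), (Running Skip, Dec 1, Accepting)} \<union>
    {(Running d, i, Running d') | d i d'. d \<in> derivatives c \<and> small d i d'}"

lemma finite_machine_edges: "finite (machine_edges c)"
proof -
  have "{(Running d, i, Running d') | d i d'. d \<in> derivatives c \<and> small d i d'} =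
      (\<lambda>(d, i, d'). (Running d, i, Running d')) ` (SIGMA d:derivatives c. {(i, d'). small d i d'})"
    by (auto simp: image_iff)
  then show ?thesis
    by (simp add: machine_edges_def finite_derivatives finite_small)
qed

lemma machine_edges_machine: "\<exists>K. machine (machine_edges c) Initial Accepting K"
proof -
  have "finite (registers i)" for i by (cases i) auto
  then have "finite (\<Union>(q, i, q')\<in>machine_edges c. registers i)"
    using finite_machine_edges by (auto intro!: finite_UN_I)
  then obtain k where k: "\<forall>j\<in>(\<Union>(q, i, q')\<in>machine_edges c. registers i). j < k"
    unfolding finite_nat_set_iff_bounded by blast
  have "machine (machine_edges c) Initial Accepting (Suc k)"
  proof
    show "finite (machine_edges c)" by (rule finite_machine_edges)
    show "registers i \<subseteq> {..<Suc k}" if "(q, i, q') \<in> machine_edges c" for q i q'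
      using k that by fastforce
    show "q' = q'' \<and> w = w'" if "(q, i, q') \<in> machine_edges c" "(q, k, q'') \<in> machine_edges c"
      "effect i v w" "effect k v w'" for q i q' k q'' v w w'
      using that small_deterministic[of _ i _ k _ v w w']
      by (auto simp: machine_edges_def elim: small_elims(1))
  qed (auto simp: machine_edges_def)
  then show ?thesis by blast
qed

theorem theorem5:
  shows "\<not> decidable inputs input_code (\<lambda>(G1, G2, A). bisimilar A G1 G2)"
proof
  assume "decidable inputs input_code (\<lambda>(G1, G2, A). bisimilar A G1 G2)"
  then obtain d where d: "\<And>G1 G2 A. (G1, G2, A) \<in> inputs \<Longrightarrow>
      evaluates d [input_code (G1, G2, A)] (if bisimilar A G1 G2 then 1 else 0)"
    unfolding decidable_def by fastforce
  obtain r where r: "\<And>as. length as = 6 \<Longrightarrow>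
      evaluates r [tuple as] (eval_expr input_expr (tuple as # as))"
    using input_code_evaluates by blast
  define c where "c = compile (Comp d [r]) [0] 1 2"
  obtain K where K: "machine (machine_edges c) Initial Accepting K"
    using machine_edges_machine by blast
  interpret machine "machine_edges c" Initial Accepting K by (rule K)
  define x where "x = tuple parameters"
  interpret machine_input "machine_edges c" Initial Accepting K x
    by unfold_locales
  let ?B = "bisimilar {0, 1} (game (edge End)) (game (edge End2))"
  have "evaluates r [x] (input_code (game (edge End), game (edge End2), {0, 1}))"
    unfolding input_code_expr unfolding x_def by (rule r) (rule length_parameters)
  from evaluates_Comp1[OF this d[OF inputs]]
  have "evaluates (Comp d [r]) (map (input x) [0]) (if ?B then 1 else 0)"
    by (simp add: input_def)
  then obtain w where w: "runs c (input x) w" "w 1 = (if ?B then 1 else 0)"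
    unfolding c_def by (rule computesE[OF compile_computes, where m = 2 and out = 1]) auto
  have "step\<^sup>*\<^sup>* (Running c, input x) (Running d, u) \<and> d \<in> derivatives c"
    if "small_step\<^sup>*\<^sup>* (c, input x) (d, u)" for d u
    using that
  proof (induction rule: rtranclp_induct2)
    case refl
    show ?case by (simp add: self_derivative)
  next
    case (step d u d' u')
    then obtain i where i: "small d i d'" "effect i u u'" by (auto simp: small_step_def)
    then have "(Running d, i, Running d') \<in> machine_edges c"
      using step.IH by (auto simp: machine_edges_def)
    then have "step (Running d, u) (Running d', u')" by (rule stepI) (rule i(2))
    with step.IH i(1) show ?case
      by (meson rtranclp.rtrancl_into_rtrancl small_derivatives)
  qed
  then have "step\<^sup>*\<^sup>* (Running c, input x) (Running Skip, w)"
    using w(1) by (simp add: runs_def)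
  moreover have "step (Initial, input x) (Running c, input x)"
    by (rule stepI[of _ Nop]) (simp_all add: machine_edges_def)
  ultimately have steps: "step\<^sup>*\<^sup>* (Initial, input x) (Running Skip, w)" by simp
  show False
  proof (cases ?B)
    case True
    then have "step (Running Skip, w) (Accepting, w(1 := 0))"
      using w(2) by (intro stepI[of _ "Dec 1"]) (simp_all add: machine_edges_def)
    with steps have "step\<^sup>*\<^sup>* (Initial, input x) (Accepting, w(1 := 0))" by simp
    with True show False using not_bisimilar_if_accepts by blast
  next
    case False
    then have "\<nexists>s. step (Running Skip, w) s"
      using w(2) unfolding step_def by (auto simp: machine_edges_def elim: small_elims(1))
    with steps have ?B by (intro bisimilar_if_rejects) auto
    with False show False ..
  qed
qed

end
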